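(* Let $\Lambda$ be a finitely aligned $k$-graph. The map $\mathcal{E}\mapsto\overline{\mathcal{E}}$ is a bijection from the set of efficient subsets $\mathcal{E}\subseteq \mathrm{FE}(\Lambda^1)$ onto the set of satiated subsets $\mathcal{F}\subseteq \mathrm{FE}(\Lambda)$, with inverse given by $\mathcal{F}\mapsto \min(\mathcal{F}\cap \mathrm{FE}(\Lambda^1))$.
   Context: A $k$-graph ($k\ge 1$) is a countable category $\Lambda$ with a functor $d:\Lambda\to\mathbb{N}^k$ such that whenever $d(\lambda)=m+n$ there are unique $\mu,\nu\in\Lambda$ with $\lambda=\mu\nu$, $d(\mu)=m$, $d(\nu)=n$; write $\lambda(0,m)=\mu$. $\Lambda^n:=d^{-1}(n)$; $\Lambda^0$ is identified with the objects (vertices); $r,s:\Lambda\to\Lambda^0$ are codomain and domain, so $\lambda\mu$ is defined iff $s(\lambda)=r(\mu)$. $\Lambda^1:=\bigcup_{i=1}^k\Lambda^{e_i}$ is the set of edges ($e_i$ the standard basis of $\mathbb{N}^k$). For $v\in\Lambda^0$, $E\subseteq\Lambda$: $vE:=\{\mu\in E:r(\mu)=v\}$ and $E\Lambda:=\{\mu\nu:\mu\in E,\nu\in\Lambda,s(\mu)=r(\nu)\}$. With $\vee$ the coordinatewise maximum, $\mathrm{MCE}(\lambda,\mu):=\{\tau\in\Lambda^{d(\lambda)\vee d(\mu)}:\tau(0,d(\lambda))=\lambda,\ \tau(0,d(\mu))=\mu\}$ and $\Lambda^{\min}(\lambda,\mu):=\{(\lambda',\mu'):\lambda\lambda'=\mu\mu'\in\mathrm{MCE}(\lambda,\mu)\}$.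 $\Lambda$ is finitely aligned if every $\Lambda^{\min}(\lambda,\mu)$ is finite. A set $E\subseteq v\Lambda$ is exhaustive if for every $\lambda\in v\Lambda$ there is $\mu\in E$ with $\Lambda^{\min}(\lambda,\mu)\neq\emptyset$. $\mathrm{FE}(\Lambda)$ is the collection of all finite exhaustive sets $E\subseteq v\Lambda\setminus\{v\}$, $v\in\Lambda^0$; for such $E$ put $r(E):=v$. $\mathrm{FE}(\Lambda^1):=\{E\in\mathrm{FE}(\Lambda):E\subseteq\Lambda^1\}$. For a collection $\mathcal{E}\subseteq\mathrm{FE}(\Lambda)$, $v\mathcal{E}:=\{E\in\mathcal{E}:r(E)=v\}$. For $E\subseteq r(\lambda)\Lambda$, $\mathrm{Ext}_\Lambda(\lambda;E):=\{g\in s(\lambda)\Lambda:\lambda g\in\mathrm{MCE}(\lambda,e)\text{ for some }e\in E\}$. A subset $\mathcal{E}\subseteq\mathrm{FE}(\Lambda^1)$ is efficient if: (E1) $E,F\in\mathcal{E}$, $E\subseteq F$ imply $E=F$; (E2) if $E\in\mathcal{E}$ and $f\in r(E)\Lambda^1\setminus E$, there is $F\in\mathcal{E}$ with $F\subseteq\mathrm{Ext}_\Lambda(f;E)$; (E3) if $E\in\mathcal{E}$, $e\in E$ and $F\in s(e)\mathcal{E}$, there is $G\in\mathcal{E}$ with $G\subseteq(E\setminus\{e\})\cup\{(ef)(0,d(f)):f\in F\}$. For $\mathcal{G}\subseteq\mathrm{FE}(\Lambda^1)$, $\min(\mathcal{G}):=\{E\in\mathcal{G}:F\in\mathcal{G},F\subseteq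 E\Rightarrow F=E\}$. A subset $\mathcal{F}\subseteq\mathrm{FE}(\Lambda)$ is satiated if: (S1) $E\in\mathcal{F}$, $F\in\mathrm{FE}(\Lambda)$, $E\subseteq F$ imply $F\in\mathcal{F}$; (S2) $E\in\mathcal{F}$ and $\lambda\in r(E)\Lambda\setminus E\Lambda$ imply $\mathrm{Ext}_\Lambda(\lambda;E)\in\mathcal{F}$; (S3) if $E\in\mathcal{F}$ and for each $\lambda\in E$ we have $n_\lambda\in\mathbb{N}^k$ with $n_\lambda\neq0$, $n_\lambda\le d(\lambda)$, then $\{\lambda(0,n_\lambda):\lambda\in E\}\in\mathcal{F}$; (S4) if $E\in\mathcal{F}$, $E'\subseteq E$ and $E'_\lambda\in s(\lambda)\mathcal{F}$ for each $\lambda\in E'$, then $(E\setminus E')\cup\bigcup_{\lambda\in E'}\lambda E'_\lambda\in\mathcal{F}$. The satiation $\overline{\mathcal{F}}$ of $\mathcal{F}\subseteq\mathrm{FE}(\Lambda)$ is the smallest satiated subset of $\mathrm{FE}(\Lambda)$ containing $\mathcal{F}$. *)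

theory Defs
  imports Complex_Main "HOL-Library.Function_Algebras" "HOL-Library.Countable_Set"
begin

text \<open>
  Degrees live in the monoid of functions \<open>'k \<Rightarrow> nat\<close> for a finite (nonempty) index type \<open>'k\<close>,
  so that \<open>k = CARD('k) \<ge> 1\<close>; addition, \<open>0\<close>, \<open>\<le>\<close> and \<open>sup\<close> are all coordinatewise.
  A small category is given by its set of arrows, each object being represented by its identity
  arrow: \<open>rng\<close> (codomain) and \<open>src\<close> (domain) return identity arrows. The values of the operations
  are meaningful only on \<open>arr\<close>, and composition only on pairs with \<open>src \<mu> = rng \<nu>\<close>.
\<close>

record ('a, 'k) k_graph_data =
  arr :: "'a set"
  rng :: "'a \<Rightarrow> 'a"
  src :: "'a \<Rightarrow> 'a"
  comp :: "'a \<Rightarrow> 'a \<Rightarrow> 'a" (infixl "\<cdot>\<index>" 70)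
  deg :: "'a \<Rightarrow> 'k \<Rightarrow> nat"

locale k_graph =
  fixes \<Lambda> :: "('a, 'k::finite) k_graph_data" (structure)
  assumes countable_arr: "countable (arr \<Lambda>)"
    and rng_arr: "\<mu> \<in> arr \<Lambda> \<Longrightarrow> rng \<Lambda> \<mu> \<in> arr \<Lambda>"
    and src_arr: "\<mu> \<in> arr \<Lambda> \<Longrightarrow> src \<Lambda> \<mu> \<in> arr \<Lambda>"
    and rng_rng: "\<mu> \<in> arr \<Lambda> \<Longrightarrow> rng \<Lambda> (rng \<Lambda> \<mu>) = rng \<Lambda> \<mu>"
    and src_rng: "\<mu> \<in> arr \<Lambda> \<Longrightarrow> src \<Lambda> (rng \<Lambda> \<mu>) = rng \<Lambda> \<mu>"
    and rng_src: "\<mu> \<in> arr \<Lambda> \<Longrightarrow> rng \<Lambda> (src \<Lambda> \<mu>) = src \<Lambda> \<mu>"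
    and src_src: "\<mu> \<in> arr \<Lambda> \<Longrightarrow> src \<Lambda> (src \<Lambda> \<mu>) = src \<Lambda> \<mu>"
    and comp_arr: "\<lbrakk>\<mu> \<in> arr \<Lambda>; \<nu> \<in> arr \<Lambda>; src \<Lambda> \<mu> = rng \<Lambda> \<nu>\<rbrakk> \<Longrightarrow> \<mu> \<cdot> \<nu> \<in> arr \<Lambda>"
    and rng_comp: "\<lbrakk>\<mu> \<in> arr \<Lambda>; \<nu> \<in> arr \<Lambda>; src \<Lambda> \<mu> = rng \<Lambda> \<nu>\<rbrakk> \<Longrightarrow> rng \<Lambda> (\<mu> \<cdot> \<nu>) = rng \<Lambda> \<mu>"
    and src_comp: "\<lbrakk>\<mu> \<in> arr \<Lambda>; \<nu> \<in> arr \<Lambda>; src \<Lambda> \<mu> = rng \<Lambda> \<nu>\<rbrakk> \<Longrightarrow> src \<Lambda> (\<mu> \<cdot> \<nu>) = src \<Lambda> \<nu>"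
    and rng_left_id: "\<mu> \<in> arr \<Lambda> \<Longrightarrow> rng \<Lambda> \<mu> \<cdot> \<mu> = \<mu>"
    and src_right_id: "\<mu> \<in> arr \<Lambda> \<Longrightarrow> \<mu> \<cdot> src \<Lambda> \<mu> = \<mu>"
    and comp_assoc: "\<lbrakk>\<mu> \<in> arr \<Lambda>; \<nu> \<in> arr \<Lambda>; \<rho> \<in> arr \<Lambda>; src \<Lambda> \<mu> = rng \<Lambda> \<nu>; src \<Lambda> \<nu> = rng \<Lambda> \<rho>\<rbrakk>
           \<Longrightarrow> \<mu> \<cdot> \<nu> \<cdot> \<rho> = \<mu> \<cdot> (\<nu> \<cdot> \<rho>)"
    and deg_rng: "\<mu> \<in> arr \<Lambda> \<Longrightarrow> deg \<Lambda> (rng \<Lambda> \<mu>) = 0"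
    and deg_src: "\<mu> \<in> arr \<Lambda> \<Longrightarrow> deg \<Lambda> (src \<Lambda> \<mu>) = 0"
    and deg_comp: "\<lbrakk>\<mu> \<in> arr \<Lambda>; \<nu> \<in> arr \<Lambda>; src \<Lambda> \<mu> = rng \<Lambda> \<nu>\<rbrakk>
           \<Longrightarrow> deg \<Lambda> (\<mu> \<cdot> \<nu>) = deg \<Lambda> \<mu> + deg \<Lambda> \<nu>"
    and factorization: "\<lbrakk>\<tau> \<in> arr \<Lambda>; deg \<Lambda> \<tau> = m + n\<rbrakk>
           \<Longrightarrow> \<exists>!p. p \<in> {(\<mu>, \<nu>). \<mu> \<in> arr \<Lambda> \<and> \<nu> \<in> arr \<Lambda> \<and> src \<Lambda> \<mu> = rng \<Lambda> \<nu>
                              \<and> \<tau> = \<mu> \<cdot> \<nu> \<and> deg \<Lambda> \<mu> = m \<and> deg \<Lambda> \<nu> = n}"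

definition paths_deg :: "('a, 'k::finite) k_graph_data \<Rightarrow> ('k \<Rightarrow> nat) \<Rightarrow> 'a set" where
  "paths_deg \<Lambda> n = {\<mu> \<in> arr \<Lambda>. deg \<Lambda> \<mu> = n}"

definition vertices :: "('a, 'k::finite) k_graph_data \<Rightarrow> 'a set" where
  "vertices \<Lambda> = paths_deg \<Lambda> 0"

text \<open>The identification of the objects with the arrows of degree \<open>0\<close>.\<close>

lemma (in k_graph) vertices_eq_objects:
  "vertices \<Lambda> = rng \<Lambda> ` arr \<Lambda>" "vertices \<Lambda> = src \<Lambda> ` arr \<Lambda>"
proof -
  have eq: "rng \<Lambda> v = v \<and> src \<Lambda> v = v" if v: "v \<in> arr \<Lambda>" "deg \<Lambda> v = 0" for v
  proof -
    let ?S = "{(\<mu>, \<nu>). \<mu> \<in> arr \<Lambda> \<and> \<nu> \<in> arr \<Lambda> \<and> src \<Lambda> \<mu> = rng \<Lambda> \<nu>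
                \<and> v = \<mu> \<cdot> \<nu> \<and> deg \<Lambda> \<mu> = 0 \<and> deg \<Lambda> \<nu> = 0}"
    have ex1: "\<exists>!p. p \<in> ?S"
      using factorization[OF v(1), of 0 0] v(2) by simp
    have "(rng \<Lambda> v, v) \<in> ?S" "(v, src \<Lambda> v) \<in> ?S"
      using v by (simp_all add: rng_arr src_arr rng_src src_rng rng_left_id src_right_id deg_rng deg_src)
    then have "(rng \<Lambda> v, v) = (v, src \<Lambda> v)" using ex1 by blast
    then show ?thesis by simp
  qed
  show "vertices \<Lambda> = rng \<Lambda> ` arr \<Lambda>"
    using eq by (force simp: vertices_def paths_deg_def rng_arr deg_rng image_iff)
  show "vertices \<Lambda> = src \<Lambda> ` arr \<Lambda>"
    using eq by (force simp: vertices_def paths_deg_def src_arr deg_src image_iff)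
qed

definition edges :: "('a, 'k::finite) k_graph_data \<Rightarrow> 'a set" where
  "edges \<Lambda> = (\<Union>i. paths_deg \<Lambda> (\<lambda>j. if j = i then 1 else 0))"

text \<open>\<open>vE\<close> and \<open>E\<Lambda>\<close>.\<close>

definition paths_at :: "('a, 'k::finite) k_graph_data \<Rightarrow> 'a \<Rightarrow> 'a set \<Rightarrow> 'a set" where
  "paths_at \<Lambda> v E = {\<mu> \<in> E. rng \<Lambda> \<mu> = v}"

definition right_extensions :: "('a, 'k::finite) k_graph_data \<Rightarrow> 'a set \<Rightarrow> 'a set" where
  "right_extensions \<Lambda> E = {comp \<Lambda> \<mu> \<nu> | \<mu> \<nu>. \<mu> \<in> E \<and> \<nu> \<in> arr \<Lambda> \<and> src \<Lambda> \<mu> = rng \<Lambda> \<nu>}"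

text \<open>The initial segment \<open>\<tau>(0,m)\<close>, meaningful for \<open>\<tau> \<in> arr \<Lambda>\<close> and \<open>m \<le> deg \<Lambda> \<tau>\<close>.\<close>

definition initial :: "('a, 'k::finite) k_graph_data \<Rightarrow> 'a \<Rightarrow> ('k \<Rightarrow> nat) \<Rightarrow> 'a" where
  "initial \<Lambda> \<tau> m = (THE \<mu>. \<mu> \<in> paths_deg \<Lambda> m
      \<and> (\<exists>\<nu> \<in> arr \<Lambda>. src \<Lambda> \<mu> = rng \<Lambda> \<nu> \<and> \<tau> = comp \<Lambda> \<mu> \<nu>))"

definition MCE :: "('a, 'k::finite) k_graph_data \<Rightarrow> 'a \<Rightarrow> 'a \<Rightarrow> 'a set" where
  "MCE \<Lambda> \<mu> \<nu> = {\<tau> \<in> paths_deg \<Lambda> (sup (deg \<Lambda> \<mu>) (deg \<Lambda> \<nu>)).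
      initial \<Lambda> \<tau> (deg \<Lambda> \<mu>) = \<mu> \<and> initial \<Lambda> \<tau> (deg \<Lambda> \<nu>) = \<nu>}"

definition Lambda_min :: "('a, 'k::finite) k_graph_data \<Rightarrow> 'a \<Rightarrow> 'a \<Rightarrow> ('a \<times> 'a) set" where
  "Lambda_min \<Lambda> \<mu> \<nu> = {(\<alpha>, \<beta>). \<alpha> \<in> arr \<Lambda> \<and> \<beta> \<in> arr \<Lambda> \<and> src \<Lambda> \<mu> = rng \<Lambda> \<alpha> \<and> src \<Lambda> \<nu> = rng \<Lambda> \<beta>
      \<and> comp \<Lambda> \<mu> \<alpha> = comp \<Lambda> \<nu> \<beta> \<and> comp \<Lambda> \<mu> \<alpha> \<in> MCE \<Lambda> \<mu> \<nu>}"

locale finitely_aligned_k_graph = k_graph +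
  assumes finite_Lambda_min: "\<lbrakk>\<mu> \<in> arr \<Lambda>; \<nu> \<in> arr \<Lambda>\<rbrakk> \<Longrightarrow> finite (Lambda_min \<Lambda> \<mu> \<nu>)"

definition exhaustive :: "('a, 'k::finite) k_graph_data \<Rightarrow> 'a \<Rightarrow> 'a set \<Rightarrow> bool" where
  "exhaustive \<Lambda> v E \<longleftrightarrow> E \<subseteq> paths_at \<Lambda> v (arr \<Lambda>)
      \<and> (\<forall>\<mu> \<in> paths_at \<Lambda> v (arr \<Lambda>). \<exists>\<nu> \<in> E. Lambda_min \<Lambda> \<mu> \<nu> \<noteq> {})"

definition FE :: "('a, 'k::finite) k_graph_data \<Rightarrow> 'a set set" where
  "FE \<Lambda> = {E. finite E \<and> (\<exists>v \<in> vertices \<Lambda>. v \<notin> E \<and> exhaustive \<Lambda> v E)}"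

definition FE_edges :: "('a, 'k::finite) k_graph_data \<Rightarrow> 'a set set" where
  "FE_edges \<Lambda> = {E \<in> FE \<Lambda>. E \<subseteq> edges \<Lambda>}"

text \<open>\<open>r(E)\<close> for \<open>E \<in> FE \<Lambda>\<close>; exhaustive sets are nonempty, so the vertex is unique.\<close>

definition range_vertex :: "('a, 'k::finite) k_graph_data \<Rightarrow> 'a set \<Rightarrow> 'a" where
  "range_vertex \<Lambda> E = (THE v. v \<in> vertices \<Lambda> \<and> E \<subseteq> paths_at \<Lambda> v (arr \<Lambda>))"

definition sets_at :: "('a, 'k::finite) k_graph_data \<Rightarrow> 'a \<Rightarrow> 'a set set \<Rightarrow> 'a set set" where
  "sets_at \<Lambda> v \<E> = {E \<in> \<E>. range_vertex \<Lambda> E = v}"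

definition Ext :: "('a, 'k::finite) k_graph_data \<Rightarrow> 'a \<Rightarrow> 'a set \<Rightarrow> 'a set" where
  "Ext \<Lambda> \<mu> E = {g \<in> paths_at \<Lambda> (src \<Lambda> \<mu>) (arr \<Lambda>). \<exists>e \<in> E. comp \<Lambda> \<mu> g \<in> MCE \<Lambda> \<mu> e}"

definition efficient :: "('a, 'k::finite) k_graph_data \<Rightarrow> 'a set set \<Rightarrow> bool" where
  "efficient \<Lambda> \<E> \<longleftrightarrow> \<E> \<subseteq> FE_edges \<Lambda>
    \<and> (\<forall>E \<in> \<E>. \<forall>F \<in> \<E>. E \<subseteq> F \<longrightarrow> E = F)
    \<and> (\<forall>E \<in> \<E>. \<forall>f \<in> paths_at \<Lambda> (range_vertex \<Lambda> E) (edges \<Lambda>) - E. \<exists>F \<in> \<E>. F \<subseteq> Ext \<Lambda> f E)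
    \<and> (\<forall>E \<in> \<E>. \<forall>e \<in> E. \<forall>F \<in> sets_at \<Lambda> (src \<Lambda> e) \<E>.
         \<exists>G \<in> \<E>. G \<subseteq> (E - {e}) \<union> {initial \<Lambda> (comp \<Lambda> e f) (deg \<Lambda> f) | f. f \<in> F})"

definition min_sets :: "'a set set \<Rightarrow> 'a set set" where
  "min_sets \<G> = {E \<in> \<G>. \<forall>F \<in> \<G>. F \<subseteq> E \<longrightarrow> F = E}"

definition satiated :: "('a, 'k::finite) k_graph_data \<Rightarrow> 'a set set \<Rightarrow> bool" where
  "satiated \<Lambda> \<F> \<longleftrightarrow> \<F> \<subseteq> FE \<Lambda>
    \<and> (\<forall>E \<in> \<F>. \<forall>F \<in> FE \<Lambda>. E \<subseteq> F \<longrightarrow> F \<in> \<F>)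
    \<and> (\<forall>E \<in> \<F>. \<forall>\<mu> \<in> paths_at \<Lambda> (range_vertex \<Lambda> E) (arr \<Lambda>) - right_extensions \<Lambda> E. Ext \<Lambda> \<mu> E \<in> \<F>)
    \<and> (\<forall>E \<in> \<F>. \<forall>n. (\<forall>\<mu> \<in> E. n \<mu> \<noteq> 0 \<and> n \<mu> \<le> deg \<Lambda> \<mu>) \<longrightarrow> (\<lambda>\<mu>. initial \<Lambda> \<mu> (n \<mu>)) ` E \<in> \<F>)
    \<and> (\<forall>E \<in> \<F>. \<forall>E'. E' \<subseteq> E \<longrightarrow> (\<forall>X. (\<forall>\<mu> \<in> E'. X \<mu> \<in> sets_at \<Lambda> (src \<Lambda> \<mu>) \<F>) \<longrightarrow>
         (E - E') \<union> (\<Union>\<mu> \<in> E'. comp \<Lambda> \<mu> ` X \<mu>) \<in> \<F>))"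

text \<open>The least satiated collection (with respect to inclusion) containing \<open>\<F>\<close>.\<close>

definition satiation :: "('a, 'k::finite) k_graph_data \<Rightarrow> 'a set set \<Rightarrow> 'a set set" where
  "satiation \<Lambda> \<F> = (LEAST \<G>. satiated \<Lambda> \<G> \<and> \<F> \<subseteq> \<G>)"

end

theory Submission
  imports Defs
begin

text \<open>
  Call a finite \<open>F \<subseteq> v\<Lambda>\<close> a bar for \<open>\<E>\<close> at \<open>v\<close> if \<open>v \<in> F\<close>, or if some \<open>E \<in> v\<E>\<close> has the property that
  \<open>Ext(e;F)\<close> is recursively a bar at \<open>s(e)\<close> for every \<open>e \<in> E\<close>. For efficient \<open>\<E>\<close>, the bars that avoid
  their vertex form the satiation of \<open>\<E>\<close>. Indeed, since \<open>Ext(\<mu>\<nu>;F) = Ext(\<nu>;Ext(\<mu>;F))\<close>, (E2) shows that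
  bars are stable under \<open>Ext\<close>, and then \<open>F'\<close> is a bar whenever \<open>F\<close> is a bar and \<open>Ext(\<mu>;F')\<close> is one
  for each \<open>\<mu> \<in> F\<close>; this yields (S1), (S3) and (S4). Conversely, grafting with (S4) and truncating with
  (S3) puts every bar into every satiated collection containing \<open>\<E>\<close>. By (E3), a bar consisting of
  edges contains a member of \<open>\<E>\<close>, so \<open>\<E>\<close> is recovered as the minimal edge sets of its satiation.
  Finally, in a satiated \<open>\<F>\<close> the first edges of the paths in \<open>F \<in> \<F>\<close> again form a member of \<open>\<F>\<close>, and
  passing from \<open>F\<close> to \<open>Ext(e;F)\<close> for such an edge lowers the join of the degrees; so \<open>F\<close> is a bar
  for \<open>min(\<F> \<inter> FE(\<Lambda>\<^sup>1))\<close>.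
\<close>

section \<open>Factorisation and minimal common extensions\<close>

context k_graph
begin

text \<open>A relational form of initial segments. In contrast to \<open>initial\<close>, it
  mentions no degree and carries its own domain conditions, so that it composes as an order.\<close>

definition prefix (infix "\<preceq>" 50) where
  "\<mu> \<preceq> \<tau> \<longleftrightarrow> \<mu> \<in> arr \<Lambda> \<and> (\<exists>\<nu> \<in> arr \<Lambda>. src \<Lambda> \<mu> = rng \<Lambda> \<nu> \<and> \<tau> = \<mu> \<cdot> \<nu>)"

lemma prefixI: "\<mu> \<in> arr \<Lambda> \<Longrightarrow> \<nu> \<in> arr \<Lambda> \<Longrightarrow> src \<Lambda> \<mu> = rng \<Lambda> \<nu> \<Longrightarrow> \<mu> \<preceq> \<mu> \<cdot> \<nu>"
  by (auto simp: prefix_def)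

lemma prefixE:
  assumes "\<mu> \<preceq> \<tau>"
  obtains \<nu> where "\<nu> \<in> arr \<Lambda>" "src \<Lambda> \<mu> = rng \<Lambda> \<nu>" "\<tau> = \<mu> \<cdot> \<nu>"
  using assms by (auto simp: prefix_def)

lemma prefix_arr: "\<mu> \<preceq> \<tau> \<Longrightarrow> \<mu> \<in> arr \<Lambda>" "\<mu> \<preceq> \<tau> \<Longrightarrow> \<tau> \<in> arr \<Lambda>"
  by (auto simp: prefix_def comp_arr)

lemma prefix_rng: "\<mu> \<preceq> \<tau> \<Longrightarrow> rng \<Lambda> \<mu> = rng \<Lambda> \<tau>"
  by (auto simp: prefix_def rng_comp)

lemma prefix_refl: "\<mu> \<in> arr \<Lambda> \<Longrightarrow> \<mu> \<preceq> \<mu>"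
  using prefixI[of \<mu> "src \<Lambda> \<mu>"] by (simp add: src_right_id src_arr rng_src)

lemma prefix_trans:
  assumes "\<mu> \<preceq> \<nu>" "\<nu> \<preceq> \<tau>"
  shows "\<mu> \<preceq> \<tau>"
proof -
  obtain \<alpha> where \<alpha>: "\<mu> \<in> arr \<Lambda>" "\<alpha> \<in> arr \<Lambda>" "src \<Lambda> \<mu> = rng \<Lambda> \<alpha>" "\<nu> = \<mu> \<cdot> \<alpha>"
    using assms(1) by (auto simp: prefix_def)
  obtain \<beta> where \<beta>: "\<beta> \<in> arr \<Lambda>" "src \<Lambda> \<nu> = rng \<Lambda> \<beta>" "\<tau> = \<nu> \<cdot> \<beta>"
    using assms(2) by (rule prefixE)
  have "src \<Lambda> \<alpha> = rng \<Lambda> \<beta>" using \<alpha> \<beta> by (simp add: src_comp)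
  then show ?thesis
    using prefixI[of \<mu> "\<alpha> \<cdot> \<beta>"] \<alpha> \<beta> by (simp add: comp_arr comp_assoc rng_comp)
qed

lemma prefix_deg_le: "\<mu> \<preceq> \<tau> \<Longrightarrow> deg \<Lambda> \<mu> \<le> deg \<Lambda> \<tau>"
  by (auto simp: prefix_def deg_comp le_fun_def)

text \<open>Degrees are additive and cancellative, so equal degrees of the first factors force equal
  degrees of the second ones. Both pairs are then factorisations of one path for the same splitting
  of its degree.\<close>

lemma factor_unique:
  assumes "\<mu> \<in> arr \<Lambda>" "\<nu> \<in> arr \<Lambda>" "src \<Lambda> \<mu> = rng \<Lambda> \<nu>"
    and "\<mu>' \<in> arr \<Lambda>" "\<nu>' \<in> arr \<Lambda>" "src \<Lambda> \<mu>' = rng \<Lambda> \<nu>'"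
    and eq: "\<mu> \<cdot> \<nu> = \<mu>' \<cdot> \<nu>'" and deg: "deg \<Lambda> \<mu> = deg \<Lambda> \<mu>'"
  shows "\<mu> = \<mu>'" "\<nu> = \<nu>'"
proof -
  let ?S = "{(\<alpha>, \<beta>). \<alpha> \<in> arr \<Lambda> \<and> \<beta> \<in> arr \<Lambda> \<and> src \<Lambda> \<alpha> = rng \<Lambda> \<beta>
                \<and> \<mu> \<cdot> \<nu> = \<alpha> \<cdot> \<beta> \<and> deg \<Lambda> \<alpha> = deg \<Lambda> \<mu> \<and> deg \<Lambda> \<beta> = deg \<Lambda> \<nu>}"
  have "deg \<Lambda> \<mu> + deg \<Lambda> \<nu> = deg \<Lambda> \<mu>' + deg \<Lambda> \<nu>'"
    using assms by (metis deg_comp)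
  then have "deg \<Lambda> \<nu>' = deg \<Lambda> \<nu>"
    using deg by (metis add_left_cancel)
  then have "(\<mu>, \<nu>) \<in> ?S" "(\<mu>', \<nu>') \<in> ?S"
    using assms by auto
  moreover have "\<exists>!p. p \<in> ?S"
    using assms(1-3) by (intro factorization) (simp_all add: comp_arr deg_comp)
  ultimately have "(\<mu>, \<nu>) = (\<mu>', \<nu>')" by blast
  then show "\<mu> = \<mu>'" "\<nu> = \<nu>'" by auto
qed

lemma prefix_unique: "\<mu> \<preceq> \<tau> \<Longrightarrow> \<nu> \<preceq> \<tau> \<Longrightarrow> deg \<Lambda> \<mu> = deg \<Lambda> \<nu> \<Longrightarrow> \<mu> = \<nu>"
  by (auto simp: prefix_def intro: factor_unique(1))

lemma prefix_antisym_deg: "\<mu> \<preceq> \<tau> \<Longrightarrow> deg \<Lambda> \<mu> = deg \<Lambda> \<tau> \<Longrightarrow> \<mu> = \<tau>"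
  by (meson prefix_arr(2) prefix_refl prefix_unique)

lemma initial_eq:
  assumes "\<mu> \<preceq> \<tau>" shows "initial \<Lambda> \<tau> (deg \<Lambda> \<mu>) = \<mu>"
  unfolding initial_def
proof (rule the_equality)
  show "\<mu> \<in> paths_deg \<Lambda> (deg \<Lambda> \<mu>) \<and> (\<exists>\<nu>\<in>arr \<Lambda>. src \<Lambda> \<mu> = rng \<Lambda> \<nu> \<and> \<tau> = \<mu> \<cdot> \<nu>)"
    using assms by (auto simp: paths_deg_def prefix_def)
next
  fix \<alpha>
  assume "\<alpha> \<in> paths_deg \<Lambda> (deg \<Lambda> \<mu>) \<and> (\<exists>\<nu>\<in>arr \<Lambda>. src \<Lambda> \<alpha> = rng \<Lambda> \<nu> \<and> \<tau> = \<alpha> \<cdot> \<nu>)"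
  then have "\<alpha> \<preceq> \<tau>" "deg \<Lambda> \<alpha> = deg \<Lambda> \<mu>" by (auto simp: paths_deg_def prefix_def)
  then show "\<alpha> = \<mu>" using assms prefix_unique by blast
qed

lemma prefix_of_deg:
  assumes "\<tau> \<in> arr \<Lambda>" "m \<le> deg \<Lambda> \<tau>"
  obtains \<mu> where "\<mu> \<preceq> \<tau>" "deg \<Lambda> \<mu> = m"
proof -
  have "deg \<Lambda> \<tau> = m + (deg \<Lambda> \<tau> - m)"
    using assms(2) by (auto simp: fun_eq_iff le_fun_def)
  from factorization[OF assms(1) this] that show thesis
    by (auto simp: prefix_def)
qed

lemma initial_prefix:
  assumes "\<tau> \<in> arr \<Lambda>" "m \<le> deg \<Lambda> \<tau>"
  shows "initial \<Lambda> \<tau> m \<preceq> \<tau>" "deg \<Lambda> (initial \<Lambda> \<tau> m) = m"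
  using prefix_of_deg[OF assms] initial_eq by metis+

text \<open>A prefix of \<tau> is determined by its degree. The prefix of \<nu> of degree d(\<mu>)
  is also a prefix of \<tau>, hence equals \<mu>.\<close>

lemma prefix_linear:
  assumes "\<mu> \<preceq> \<tau>" "\<nu> \<preceq> \<tau>" "deg \<Lambda> \<mu> \<le> deg \<Lambda> \<nu>"
  shows "\<mu> \<preceq> \<nu>"
proof -
  obtain \<alpha> where "\<alpha> \<preceq> \<nu>" "deg \<Lambda> \<alpha> = deg \<Lambda> \<mu>"
    using prefix_of_deg assms prefix_arr by metis
  then show ?thesis using assms prefix_trans prefix_unique by metis
qed

lemma prefix_cancel:
  assumes "\<mu> \<cdot> \<nu> \<preceq> \<mu> \<cdot> \<tau>" "\<mu> \<in> arr \<Lambda>" "\<nu> \<in> arr \<Lambda>" "\<tau> \<in> arr \<Lambda>"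
    "src \<Lambda> \<mu> = rng \<Lambda> \<nu>" "src \<Lambda> \<mu> = rng \<Lambda> \<tau>"
  shows "\<nu> \<preceq> \<tau>"
proof -
  obtain \<beta> where \<beta>: "\<beta> \<in> arr \<Lambda>" "src \<Lambda> \<nu> = rng \<Lambda> \<beta>" "\<mu> \<cdot> \<tau> = \<mu> \<cdot> \<nu> \<cdot> \<beta>"
    using assms by (auto elim!: prefixE simp: src_comp)
  then have "\<mu> \<cdot> \<tau> = \<mu> \<cdot> (\<nu> \<cdot> \<beta>)" using assms by (simp add: comp_assoc)
  then have "\<tau> = \<nu> \<cdot> \<beta>"
    using factor_unique(2)[of \<mu> \<tau> \<mu> "\<nu> \<cdot> \<beta>"] assms \<beta> by (simp add: comp_arr rng_comp)
  then show ?thesis using \<beta> assms prefixI by simp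
qed

lemma prefix_comp_mono:
  assumes "\<nu> \<preceq> \<tau>" "\<mu> \<in> arr \<Lambda>" "src \<Lambda> \<mu> = rng \<Lambda> \<nu>"
  shows "\<mu> \<cdot> \<nu> \<preceq> \<mu> \<cdot> \<tau>"
proof -
  obtain \<beta> where \<beta>: "\<nu> \<in> arr \<Lambda>" "\<beta> \<in> arr \<Lambda>" "src \<Lambda> \<nu> = rng \<Lambda> \<beta>" "\<tau> = \<nu> \<cdot> \<beta>"
    using assms(1) by (auto simp: prefix_def)
  then have "\<mu> \<cdot> \<tau> = \<mu> \<cdot> \<nu> \<cdot> \<beta>" using assms by (simp add: comp_assoc)
  then show ?thesis
    using prefixI[of "\<mu> \<cdot> \<nu>" \<beta>] assms \<beta> by (simp add: comp_arr src_comp)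
qed

section \<open>Minimal common extensions and the operation \<open>Ext\<close>\<close>

lemma MCE_iff:
  assumes "\<mu> \<in> arr \<Lambda>" "\<nu> \<in> arr \<Lambda>"
  shows "\<tau> \<in> MCE \<Lambda> \<mu> \<nu> \<longleftrightarrow> \<mu> \<preceq> \<tau> \<and> \<nu> \<preceq> \<tau> \<and> deg \<Lambda> \<tau> = sup (deg \<Lambda> \<mu>) (deg \<Lambda> \<nu>)"
proof
  assume "\<tau> \<in> MCE \<Lambda> \<mu> \<nu>"
  then show "\<mu> \<preceq> \<tau> \<and> \<nu> \<preceq> \<tau> \<and> deg \<Lambda> \<tau> = sup (deg \<Lambda> \<mu>) (deg \<Lambda> \<nu>)"
    using initial_prefix(1)[of \<tau> "deg \<Lambda> \<mu>"] initial_prefix(1)[of \<tau> "deg \<Lambda> \<nu>"]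
    by (auto simp: MCE_def paths_deg_def)
next
  assume "\<mu> \<preceq> \<tau> \<and> \<nu> \<preceq> \<tau> \<and> deg \<Lambda> \<tau> = sup (deg \<Lambda> \<mu>) (deg \<Lambda> \<nu>)"
  then show "\<tau> \<in> MCE \<Lambda> \<mu> \<nu>"
    using prefix_arr(2)[of \<mu> \<tau>] by (simp add: MCE_def paths_deg_def initial_eq)
qed

text \<open>Truncate \<tau> at the join of the two degrees; by \<open>prefix_linear\<close> both
  paths remain prefixes of the truncation.\<close>

lemma common_extension_MCE:
  assumes "\<mu> \<preceq> \<tau>" "\<nu> \<preceq> \<tau>"
  obtains \<sigma> where "\<sigma> \<in> MCE \<Lambda> \<mu> \<nu>" "\<sigma> \<preceq> \<tau>"
proof -
  have "sup (deg \<Lambda> \<mu>) (deg \<Lambda> \<nu>) \<le> deg \<Lambda> \<tau>"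
    by (intro le_supI prefix_deg_le assms)
  then obtain \<sigma> where \<sigma>: "\<sigma> \<preceq> \<tau>" "deg \<Lambda> \<sigma> = sup (deg \<Lambda> \<mu>) (deg \<Lambda> \<nu>)"
    using prefix_of_deg[OF prefix_arr(2)[OF assms(1)]] by blast
  moreover have "\<mu> \<preceq> \<sigma>" "\<nu> \<preceq> \<sigma>"
    using prefix_linear[OF assms(1) \<sigma>(1)] prefix_linear[OF assms(2) \<sigma>(1)] \<sigma>(2) by simp_all
  ultimately show thesis using that assms prefix_arr(1) by (simp add: MCE_iff)
qed

text \<open>Exhaustiveness can therefore be tested with common extensions of arbitrary
  degree.\<close>

lemma Lambda_min_nonempty_iff:
  assumes "\<mu> \<in> arr \<Lambda>" "\<nu> \<in> arr \<Lambda>"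
  shows "Lambda_min \<Lambda> \<mu> \<nu> \<noteq> {} \<longleftrightarrow> (\<exists>\<tau>. \<mu> \<preceq> \<tau> \<and> \<nu> \<preceq> \<tau>)"
proof
  assume "Lambda_min \<Lambda> \<mu> \<nu> \<noteq> {}"
  then show "\<exists>\<tau>. \<mu> \<preceq> \<tau> \<and> \<nu> \<preceq> \<tau>"
    using assms by (fastforce simp: Lambda_min_def MCE_iff)
next
  assume "\<exists>\<tau>. \<mu> \<preceq> \<tau> \<and> \<nu> \<preceq> \<tau>"
  then obtain \<sigma> where \<sigma>: "\<sigma> \<in> MCE \<Lambda> \<mu> \<nu>" using common_extension_MCE by metis
  then have "\<mu> \<preceq> \<sigma>" "\<nu> \<preceq> \<sigma>" using assms by (auto simp: MCE_iff)
  then obtain \<alpha> \<beta> where "\<alpha> \<in> arr \<Lambda>" "src \<Lambda> \<mu> = rng \<Lambda> \<alpha>" "\<sigma> = \<mu> \<cdot> \<alpha>"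
    "\<beta> \<in> arr \<Lambda>" "src \<Lambda> \<nu> = rng \<Lambda> \<beta>" "\<sigma> = \<nu> \<cdot> \<beta>"
    by (auto simp: prefix_def)
  then have "(\<alpha>, \<beta>) \<in> Lambda_min \<Lambda> \<mu> \<nu>" using \<sigma> by (auto simp: Lambda_min_def)
  then show "Lambda_min \<Lambda> \<mu> \<nu> \<noteq> {}" by auto
qed

lemma Ext_iff:
  assumes "\<mu> \<in> arr \<Lambda>" "E \<subseteq> arr \<Lambda>"
  shows "g \<in> Ext \<Lambda> \<mu> E \<longleftrightarrow> g \<in> arr \<Lambda> \<and> src \<Lambda> \<mu> = rng \<Lambda> g
    \<and> (\<exists>e\<in>E. e \<preceq> \<mu> \<cdot> g \<and> deg \<Lambda> (\<mu> \<cdot> g) = sup (deg \<Lambda> \<mu>) (deg \<Lambda> e))"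
  using assms prefixI[of \<mu> g] by (auto simp: Ext_def paths_at_def subset_iff MCE_iff)

lemma Ext_paths_at: "Ext \<Lambda> \<mu> E \<subseteq> paths_at \<Lambda> (src \<Lambda> \<mu>) (arr \<Lambda>)"
  by (auto simp: Ext_def)

text \<open>Forwards, the common extension \<mu>\<nu>h of \<mu> and e is cut down to a minimal one,
  \<mu>g, and cancelling \<mu> makes g a prefix of \<nu>h. Backwards, prefixes are composed. In both
  directions the degree condition is a coordinatewise identity for maxima.\<close>

lemma Ext_comp:
  assumes \<mu>: "\<mu> \<in> arr \<Lambda>" and \<nu>: "\<nu> \<in> arr \<Lambda>" and sr: "src \<Lambda> \<mu> = rng \<Lambda> \<nu>"
    and E: "E \<subseteq> arr \<Lambda>"
  shows "Ext \<Lambda> (\<mu> \<cdot> \<nu>) E = Ext \<Lambda> \<nu> (Ext \<Lambda> \<mu> E)"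
proof (intro set_eqI)
  fix h
  note \<mu>\<nu> = comp_arr[OF \<mu> \<nu> sr]
  have X: "Ext \<Lambda> \<mu> E \<subseteq> arr \<Lambda>" using Ext_paths_at by (auto simp: paths_at_def)
  show "h \<in> Ext \<Lambda> (\<mu> \<cdot> \<nu>) E \<longleftrightarrow> h \<in> Ext \<Lambda> \<nu> (Ext \<Lambda> \<mu> E)"
  proof (cases "h \<in> arr \<Lambda> \<and> src \<Lambda> \<nu> = rng \<Lambda> h")
    case False
    then show ?thesis using \<mu> \<nu> sr by (auto simp: Ext_def paths_at_def src_comp)
  next
    case True
    then have h: "h \<in> arr \<Lambda>" "src \<Lambda> \<nu> = rng \<Lambda> h" by auto
    have \<nu>h: "\<nu> \<cdot> h \<in> arr \<Lambda>" "src \<Lambda> \<mu> = rng \<Lambda> (\<nu> \<cdot> h)"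
      using h \<nu> sr by (simp_all add: comp_arr rng_comp)
    have assoc: "\<mu> \<cdot> \<nu> \<cdot> h = \<mu> \<cdot> (\<nu> \<cdot> h)"
      using \<mu> \<nu> sr h by (simp add: comp_assoc)
    have deg: "deg \<Lambda> (\<mu> \<cdot> (\<nu> \<cdot> h)) = deg \<Lambda> \<mu> + deg \<Lambda> (\<nu> \<cdot> h)"
      "deg \<Lambda> (\<mu> \<cdot> \<nu>) = deg \<Lambda> \<mu> + deg \<Lambda> \<nu>"
      using \<mu> \<nu> sr \<nu>h by (simp_all add: deg_comp)
    show ?thesis
    proof
      assume "h \<in> Ext \<Lambda> (\<mu> \<cdot> \<nu>) E"
      then obtain e where e: "e \<in> E" "e \<preceq> \<mu> \<cdot> (\<nu> \<cdot> h)"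
        "deg \<Lambda> \<mu> + deg \<Lambda> (\<nu> \<cdot> h) = sup (deg \<Lambda> \<mu> + deg \<Lambda> \<nu>) (deg \<Lambda> e)"
        using \<mu>\<nu> E by (auto simp: Ext_iff assoc deg)
      have ea: "e \<in> arr \<Lambda>" using e E by auto
      have "\<mu> \<preceq> \<mu> \<cdot> (\<nu> \<cdot> h)" using prefixI \<mu> \<nu>h by simp
      then obtain \<sigma> where \<sigma>: "\<sigma> \<in> MCE \<Lambda> \<mu> e" "\<sigma> \<preceq> \<mu> \<cdot> (\<nu> \<cdot> h)"
        using common_extension_MCE e by metis
      then have "\<mu> \<preceq> \<sigma>" using \<mu> ea by (simp add: MCE_iff)
      then obtain g where g: "g \<in> arr \<Lambda>" "src \<Lambda> \<mu> = rng \<Lambda> g" "\<sigma> = \<mu> \<cdot> g"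
        by (rule prefixE)
      have gX: "g \<in> Ext \<Lambda> \<mu> E"
        using g \<sigma> e by (auto simp: Ext_def paths_at_def)
      have gh: "g \<preceq> \<nu> \<cdot> h"
        using prefix_cancel[of \<mu> g "\<nu> \<cdot> h"] g \<sigma> \<nu>h \<mu> by simp
      have "deg \<Lambda> \<mu> + deg \<Lambda> g = sup (deg \<Lambda> \<mu>) (deg \<Lambda> e)"
        using \<sigma> g \<mu> ea by (simp add: MCE_iff deg_comp)
      with e(3) have d: "deg \<Lambda> \<mu> i + deg \<Lambda> (\<nu> \<cdot> h) i = max (deg \<Lambda> \<mu> i + deg \<Lambda> \<nu> i) (deg \<Lambda> e i)"
          "deg \<Lambda> \<mu> i + deg \<Lambda> g i = max (deg \<Lambda> \<mu> i) (deg \<Lambda> e i)" for i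
        by (simp_all add: fun_eq_iff sup_nat_def)
      \<comment> \<open>Here \<open>c\<close> is the truncated difference of \<open>a\<close> and
        \<open>m\<close>, and subtracting \<open>m\<close> from \<open>max (m + n) a\<close> leaves
        \<open>max n c\<close>.\<close>
      have "b = max n c" if "m + b = max (m + n) a" "m + c = max m a" for a b c m n :: nat
        using that by linarith
      from this[OF d] have "deg \<Lambda> (\<nu> \<cdot> h) i = max (deg \<Lambda> \<nu> i) (deg \<Lambda> g i)" for i .
      then have "deg \<Lambda> (\<nu> \<cdot> h) = sup (deg \<Lambda> \<nu>) (deg \<Lambda> g)"
        by (simp add: fun_eq_iff sup_nat_def)
      with gh show "h \<in> Ext \<Lambda> \<nu> (Ext \<Lambda> \<mu> E)"
        using gX h \<nu> X by (auto simp: Ext_iff)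
    next
      assume "h \<in> Ext \<Lambda> \<nu> (Ext \<Lambda> \<mu> E)"
      then obtain g where g: "g \<in> Ext \<Lambda> \<mu> E" "g \<preceq> \<nu> \<cdot> h"
        "deg \<Lambda> (\<nu> \<cdot> h) = sup (deg \<Lambda> \<nu>) (deg \<Lambda> g)"
        using X \<nu> by (auto simp: Ext_iff)
      then obtain e where e: "e \<in> E" "e \<preceq> \<mu> \<cdot> g" "g \<in> arr \<Lambda>" "src \<Lambda> \<mu> = rng \<Lambda> g"
        "deg \<Lambda> \<mu> + deg \<Lambda> g = sup (deg \<Lambda> \<mu>) (deg \<Lambda> e)"
        using \<mu> E by (auto simp: Ext_iff deg_comp)
      have "e \<preceq> \<mu> \<cdot> (\<nu> \<cdot> h)"
        using prefix_trans prefix_comp_mono e g \<mu> by meson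
      moreover have "deg \<Lambda> \<mu> + deg \<Lambda> (\<nu> \<cdot> h) = sup (deg \<Lambda> \<mu> + deg \<Lambda> \<nu>) (deg \<Lambda> e)"
      proof
        fix i
        have "deg \<Lambda> (\<nu> \<cdot> h) i = max (deg \<Lambda> \<nu> i) (deg \<Lambda> g i)"
          "deg \<Lambda> \<mu> i + deg \<Lambda> g i = max (deg \<Lambda> \<mu> i) (deg \<Lambda> e i)"
          using g(3) e(5) by (simp_all add: fun_eq_iff sup_nat_def)
        then show "(deg \<Lambda> \<mu> + deg \<Lambda> (\<nu> \<cdot> h)) i = sup (deg \<Lambda> \<mu> + deg \<Lambda> \<nu>) (deg \<Lambda> e) i"
          by (simp add: sup_nat_def)
      qed
      ultimately show "h \<in> Ext \<Lambda> (\<mu> \<cdot> \<nu>) E"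
        using \<mu>\<nu> E e h \<nu> \<mu> sr by (auto simp: Ext_iff assoc deg src_comp)
    qed
  qed
qed

text \<open>The identity at s(\<mu>) extends \<mu> to itself, and \<mu> is a minimal common
  extension of \<mu> and e exactly when e is a prefix of \<mu>. This criterion decides where the
  recursion for bars may stop.\<close>

lemma src_in_Ext_iff:
  assumes "\<mu> \<in> arr \<Lambda>" "E \<subseteq> arr \<Lambda>"
  shows "src \<Lambda> \<mu> \<in> Ext \<Lambda> \<mu> E \<longleftrightarrow> (\<exists>e\<in>E. e \<preceq> \<mu>)"
  using assms
  by (auto simp: Ext_iff src_right_id src_arr rng_src sup_absorb1 prefix_deg_le)

text \<open>The path \<mu>\<nu> is itself the minimal common extension of \<mu> and
  \<mu>\<nu>.\<close>

lemma mem_Ext_comp: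
  assumes "\<mu> \<in> arr \<Lambda>" "\<nu> \<in> arr \<Lambda>" "src \<Lambda> \<mu> = rng \<Lambda> \<nu>" "\<mu> \<cdot> \<nu> \<in> E" "E \<subseteq> arr \<Lambda>"
  shows "\<nu> \<in> Ext \<Lambda> \<mu> E"
  using assms prefix_refl[of "\<mu> \<cdot> \<nu>"] prefix_deg_le[OF prefixI]
  by (auto simp: Ext_iff sup_absorb2 intro!: bexI[of _ "\<mu> \<cdot> \<nu>"])

section \<open>Vertices and edges\<close>

lemma vertex_simps:
  assumes "v \<in> vertices \<Lambda>"
  shows "v \<in> arr \<Lambda>" "rng \<Lambda> v = v" "src \<Lambda> v = v" "deg \<Lambda> v = 0"
  using assms vertices_eq_objects by (auto simp: src_src rng_rng src_rng rng_src rng_arr deg_rng)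

lemma vertexI: "v \<in> arr \<Lambda> \<Longrightarrow> deg \<Lambda> v = 0 \<Longrightarrow> v \<in> vertices \<Lambda>"
  by (simp add: vertices_def paths_deg_def)

lemma src_vertex: "\<mu> \<in> arr \<Lambda> \<Longrightarrow> src \<Lambda> \<mu> \<in> vertices \<Lambda>"
  using vertices_eq_objects by auto

text \<open>Joining with degree 0 changes nothing, so g must have the same degree as its prefix e
  and hence equal it. Together with \<open>Ext_comp\<close>, paths act on sets of paths through
  \<open>Ext\<close>.\<close>

lemma Ext_vertex:
  assumes "v \<in> vertices \<Lambda>" "E \<subseteq> paths_at \<Lambda> v (arr \<Lambda>)"
  shows "Ext \<Lambda> v E = E"
proof -
  have E: "E \<subseteq> arr \<Lambda>" "\<And>e. e \<in> E \<Longrightarrow> rng \<Lambda> e = v" using assms by (auto simp: paths_at_def)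
  have z: "sup 0 n = n" for n :: "'k \<Rightarrow> nat"
    by (auto simp: fun_eq_iff sup_nat_def)
  have "g \<in> Ext \<Lambda> v E \<longleftrightarrow> g \<in> E" for g
  proof -
    have "g \<in> Ext \<Lambda> v E \<longleftrightarrow> g \<in> arr \<Lambda> \<and> v = rng \<Lambda> g \<and> (\<exists>e\<in>E. e \<preceq> g \<and> deg \<Lambda> g = deg \<Lambda> e)"
      using vertex_simps[OF assms(1)] E(1) rng_left_id[of g] by (auto simp: Ext_iff z)
    also have "\<dots> \<longleftrightarrow> g \<in> E"
      using E prefix_antisym_deg[of _ g] prefix_refl[of g] by fastforce
    finally show ?thesis .
  qed
  then show ?thesis by blast
qed

lemma deg_nonzero:
  assumes "v \<in> vertices \<Lambda>" "E \<subseteq> paths_at \<Lambda> v (arr \<Lambda>)" "v \<notin> E" "\<mu> \<in> E"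
  shows "deg \<Lambda> \<mu> \<noteq> 0"
proof
  assume "deg \<Lambda> \<mu> = 0"
  then have "\<mu> \<in> vertices \<Lambda>" using assms by (auto intro!: vertexI simp: paths_at_def)
  then show False using assms vertex_simps by (auto simp: paths_at_def)
qed

lemma edge_arr: "e \<in> edges \<Lambda> \<Longrightarrow> e \<in> arr \<Lambda>"
  by (auto simp: edges_def paths_deg_def)

lemma edge_deg:
  assumes "e \<in> edges \<Lambda>"
  obtains i where "deg \<Lambda> e = (\<lambda>j. if j = i then 1 else 0)"
  using assms by (auto simp: edges_def paths_deg_def)

lemma edgeI: "e \<in> arr \<Lambda> \<Longrightarrow> deg \<Lambda> e = deg \<Lambda> f \<Longrightarrow> f \<in> edges \<Lambda> \<Longrightarrow> e \<in> edges \<Lambda>"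
  by (auto simp: edges_def paths_deg_def)

lemma edge_deg_nonzero: "e \<in> edges \<Lambda> \<Longrightarrow> deg \<Lambda> e \<noteq> 0"
  by (auto elim!: edge_deg simp: fun_eq_iff)

lemma edge_deg_le_eq:
  assumes "e \<in> edges \<Lambda>" "n \<noteq> 0" "n \<le> deg \<Lambda> e"
  shows "n = deg \<Lambda> e"
proof -
  obtain i where i: "deg \<Lambda> e = (\<lambda>j. if j = i then 1 else 0)" using assms edge_deg by blast
  have le: "n j \<le> (if j = i then 1 else 0)" for j using assms(3) by (auto simp: i le_fun_def)
  obtain j where "n j \<noteq> 0" using assms(2) by (auto simp: fun_eq_iff)
  then have "n i = 1" using le[of j] by (auto split: if_splits)
  moreover have "n j = 0" if "j \<noteq> i" for j using le[of j] that by simp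
  ultimately show ?thesis by (auto simp: i fun_eq_iff)
qed

text \<open>The only prefixes of an edge are its range and the edge itself, and the range is
  excluded from \<open>E\<close>. For edges, lying outside E\<Lambda> as in (S2) thus agrees with
  lying outside E as in (E2).\<close>

lemma edge_prefix_iff:
  assumes v: "v \<in> vertices \<Lambda>" and E: "E \<subseteq> paths_at \<Lambda> v (arr \<Lambda>)" "v \<notin> E" and e: "e \<in> edges \<Lambda>"
  shows "(\<exists>f\<in>E. f \<preceq> e) \<longleftrightarrow> e \<in> E"
proof
  assume "\<exists>f\<in>E. f \<preceq> e"
  then obtain f where f: "f \<in> E" "f \<preceq> e" by auto
  then have "deg \<Lambda> f = deg \<Lambda> e"
    using edge_deg_le_eq e prefix_deg_le deg_nonzero v E by metis
  then show "e \<in> E" using prefix_antisym_deg f by metis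
next
  assume "e \<in> E" then show "\<exists>f\<in>E. f \<preceq> e" using prefix_refl e edge_arr by auto
qed

text \<open>Were d(e) = d(f), both would be the prefix of fg of that degree, giving f = e, which
  lies in \<open>E\<close>. Distinct basis vectors have their sum as join, which leaves d(g) =
  d(e).\<close>

lemma Ext_edges:
  assumes f: "f \<in> edges \<Lambda>" "f \<notin> E" and E: "E \<subseteq> edges \<Lambda>" and g: "g \<in> Ext \<Lambda> f E"
  obtains e where "e \<in> E" "g \<in> edges \<Lambda>" "deg \<Lambda> g = deg \<Lambda> e" "e \<preceq> f \<cdot> g"
proof -
  have Ea: "E \<subseteq> arr \<Lambda>" using E edge_arr by auto
  obtain e where e: "e \<in> E" "e \<preceq> f \<cdot> g" "deg \<Lambda> f + deg \<Lambda> g = sup (deg \<Lambda> f) (deg \<Lambda> e)"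
    and ga: "g \<in> arr \<Lambda>" "src \<Lambda> f = rng \<Lambda> g"
    using g f Ea by (auto simp: Ext_iff edge_arr deg_comp)
  have ee: "e \<in> edges \<Lambda>" using E e by auto
  have "f \<preceq> f \<cdot> g" using ga f edge_arr prefixI by simp
  then have ne: "deg \<Lambda> f \<noteq> deg \<Lambda> e" using prefix_unique e f by metis
  obtain i where i: "deg \<Lambda> f = (\<lambda>j. if j = i then 1 else 0)" using f edge_deg by blast
  obtain l where l: "deg \<Lambda> e = (\<lambda>j. if j = l then 1 else 0)" using ee edge_deg by blast
  have "deg \<Lambda> g j = deg \<Lambda> e j" for j
    using fun_cong[OF e(3), of j] ne by (auto simp: i l sup_nat_def split: if_splits)
  then have "deg \<Lambda> g = deg \<Lambda> e" by auto
  then show thesis using that e ee ga edgeI by blast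
qed

section \<open>Finite exhaustive sets and their range vertex\<close>

lemma FE_iff:
  "E \<in> FE \<Lambda> \<longleftrightarrow> finite E \<and> (\<exists>v\<in>vertices \<Lambda>. v \<notin> E \<and> exhaustive \<Lambda> v E)"
  by (simp add: FE_def)

lemma range_vertex_eq:
  assumes "v \<in> vertices \<Lambda>" "E \<subseteq> paths_at \<Lambda> v (arr \<Lambda>)" "E \<noteq> {}"
  shows "range_vertex \<Lambda> E = v"
  unfolding range_vertex_def using assms by (intro the_equality) (auto simp: paths_at_def)

lemma exhaustive_nonempty:
  assumes "v \<in> vertices \<Lambda>" "exhaustive \<Lambda> v E" shows "E \<noteq> {}"
  using assms vertex_simps[OF assms(1)] by (auto simp: exhaustive_def paths_at_def)

lemma FE_cases:
  assumes "E \<in> FE \<Lambda>"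
  shows "finite E" "range_vertex \<Lambda> E \<in> vertices \<Lambda>" "range_vertex \<Lambda> E \<notin> E"
    "E \<subseteq> paths_at \<Lambda> (range_vertex \<Lambda> E) (arr \<Lambda>)" "E \<noteq> {}" "E \<subseteq> arr \<Lambda>"
    "exhaustive \<Lambda> (range_vertex \<Lambda> E) E"
proof -
  obtain v where v: "v \<in> vertices \<Lambda>" "v \<notin> E" "exhaustive \<Lambda> v E" "finite E"
    using assms by (auto simp: FE_iff)
  then have "E \<noteq> {}" "E \<subseteq> paths_at \<Lambda> v (arr \<Lambda>)" using exhaustive_nonempty by (auto simp: exhaustive_def)
  moreover from this v have "range_vertex \<Lambda> E = v" using range_vertex_eq by auto
  ultimately show "finite E" "range_vertex \<Lambda> E \<in> vertices \<Lambda>" "range_vertex \<Lambda> E \<notin> E"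
    "E \<subseteq> paths_at \<Lambda> (range_vertex \<Lambda> E) (arr \<Lambda>)" "E \<noteq> {}" "E \<subseteq> arr \<Lambda>"
    "exhaustive \<Lambda> (range_vertex \<Lambda> E) E"
    using v by (auto simp: paths_at_def)
qed

lemma FE_superset:
  assumes "E \<in> FE \<Lambda>" "E \<subseteq> F" "finite F" "F \<subseteq> paths_at \<Lambda> (range_vertex \<Lambda> E) (arr \<Lambda>)"
    "range_vertex \<Lambda> E \<notin> F"
  shows "F \<in> FE \<Lambda>"
proof -
  have "exhaustive \<Lambda> (range_vertex \<Lambda> E) F"
    using FE_cases(7)[OF assms(1)] assms(2,4) unfolding exhaustive_def by blast
  then show ?thesis using FE_cases(2)[OF assms(1)] assms by (auto simp: FE_iff)
qed

lemma FE_edgesD: "E \<in> FE_edges \<Lambda> \<Longrightarrow> E \<in> FE \<Lambda>" "E \<in> FE_edges \<Lambda> \<Longrightarrow> E \<subseteq> edges \<Lambda>"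
  by (auto simp: FE_edges_def)

lemma range_vertex_subset:
  assumes "E \<in> FE \<Lambda>" "v \<in> vertices \<Lambda>" "E \<subseteq> paths_at \<Lambda> v (arr \<Lambda>)"
  shows "range_vertex \<Lambda> E = v"
  using assms range_vertex_eq FE_cases(5) by metis

lemma rng_prefix: "\<mu> \<in> arr \<Lambda> \<Longrightarrow> rng \<Lambda> \<mu> \<preceq> \<mu>"
  using prefixI[of "rng \<Lambda> \<mu>" \<mu>] by (simp add: rng_arr src_rng rng_left_id)

lemma first_edge:
  assumes "\<mu> \<in> arr \<Lambda>" "deg \<Lambda> \<mu> i \<noteq> 0"
  obtains e where "e \<in> edges \<Lambda>" "deg \<Lambda> e = (\<lambda>j. if j = i then 1 else 0)" "e \<preceq> \<mu>"
proof -
  have "(\<lambda>j. if j = i then 1 else 0) \<le> deg \<Lambda> \<mu>" using assms(2) by (auto simp: le_fun_def)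
  then obtain e where "e \<preceq> \<mu>" "deg \<Lambda> e = (\<lambda>j. if j = i then 1 else 0)"
    using prefix_of_deg assms(1) by blast
  then show thesis using that prefix_arr(1) by (auto simp: edges_def paths_deg_def)
qed

text \<open>Edges are split off at the range end, which is the order in which
  \<open>Ext_comp\<close> unfolds; the total degree decreases.\<close>

lemma path_induct [consumes 1, case_names vertex edge]:
  assumes "\<mu> \<in> arr \<Lambda>"
    and vertex: "\<And>v. v \<in> vertices \<Lambda> \<Longrightarrow> P v"
    and edge: "\<And>e \<nu>. \<lbrakk>e \<in> edges \<Lambda>; \<nu> \<in> arr \<Lambda>; src \<Lambda> e = rng \<Lambda> \<nu>; P \<nu>\<rbrakk> \<Longrightarrow> P (e \<cdot> \<nu>)"
  shows "P \<mu>"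
  using assms(1)
proof (induction "\<Sum>i\<in>UNIV. deg \<Lambda> \<mu> i" arbitrary: \<mu> rule: less_induct)
  case less
  show ?case
  proof (cases "deg \<Lambda> \<mu> = 0")
    case True
    then show ?thesis using less vertexI vertex by blast
  next
    case False
    then obtain i where "deg \<Lambda> \<mu> i \<noteq> 0" by (auto simp: fun_eq_iff)
    then obtain e where e: "e \<in> edges \<Lambda>" "deg \<Lambda> e = (\<lambda>j. if j = i then 1 else 0)" "e \<preceq> \<mu>"
      using first_edge less by blast
    from e(3) obtain \<nu> where \<nu>: "\<nu> \<in> arr \<Lambda>" "src \<Lambda> e = rng \<Lambda> \<nu>" "\<mu> = e \<cdot> \<nu>" by (rule prefixE)
    have d: "deg \<Lambda> \<mu> = deg \<Lambda> e + deg \<Lambda> \<nu>" using \<nu> e edge_arr by (simp add: deg_comp)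
    have "(\<Sum>i\<in>UNIV. deg \<Lambda> \<nu> i) < (\<Sum>i\<in>UNIV. deg \<Lambda> \<mu> i)"
      by (rule sum_strict_mono_ex1) (auto simp: d e(2))
    then show ?thesis using less \<nu> edge e by blast
  qed
qed

end

section \<open>Bars\<close>

context k_graph
begin

inductive bar :: "'a set set \<Rightarrow> 'a \<Rightarrow> 'a set \<Rightarrow> bool" for \<E> where
  bar_vertex: "\<lbrakk>v \<in> vertices \<Lambda>; finite F; F \<subseteq> paths_at \<Lambda> v (arr \<Lambda>); v \<in> F\<rbrakk> \<Longrightarrow> bar \<E> v F"
| bar_step: "\<lbrakk>v \<in> vertices \<Lambda>; finite F; F \<subseteq> paths_at \<Lambda> v (arr \<Lambda>); E \<in> \<E>; E \<subseteq> paths_at \<Lambda> v (arr \<Lambda>);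
    \<And>e. e \<in> E \<Longrightarrow> bar \<E> (src \<Lambda> e) (Ext \<Lambda> e F)\<rbrakk> \<Longrightarrow> bar \<E> v F"

lemma barD:
  assumes "bar \<E> v F"
  shows "v \<in> vertices \<Lambda>" "finite F" "F \<subseteq> paths_at \<Lambda> v (arr \<Lambda>)" "F \<subseteq> arr \<Lambda>"
  using assms by (auto elim!: bar.cases simp: paths_at_def)

definition bars :: "'a set set \<Rightarrow> 'a set set" where
  "bars \<E> = {F. \<exists>v. bar \<E> v F \<and> v \<notin> F}"

text \<open>A path \<mu> has a common extension e\<beta> with some e in the exhaustive set
  \<open>E\<close>. By induction \<beta> meets some g in \<open>Ext \<Lambda> e F\<close>, say in
  \<sigma>; then e\<sigma> extends both \<mu> and the member of \<open>F\<close> below eg.\<close>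

lemma bar_exhaustive:
  assumes "bar \<E> v F" "\<E> \<subseteq> FE \<Lambda>"
  shows "exhaustive \<Lambda> v F"
  using assms(1)
proof induction
  case (bar_vertex v F)
  have "Lambda_min \<Lambda> \<mu> v \<noteq> {}" if "\<mu> \<in> paths_at \<Lambda> v (arr \<Lambda>)" for \<mu>
  proof -
    have "\<mu> \<in> arr \<Lambda>" "rng \<Lambda> \<mu> = v" using that by (auto simp: paths_at_def)
    then show ?thesis using rng_prefix[of \<mu>] prefix_refl rng_arr
      by (subst Lambda_min_nonempty_iff) auto
  qed
  then show ?case using bar_vertex unfolding exhaustive_def by blast
next
  case (bar_step v F E)
  have E: "exhaustive \<Lambda> v E"
    using bar_step.hyps assms(2) FE_cases(7) range_vertex_subset by (metis subsetD)
  show ?case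
    unfolding exhaustive_def
  proof (intro conjI ballI bar_step.hyps)
    fix \<mu> assume \<mu>: "\<mu> \<in> paths_at \<Lambda> v (arr \<Lambda>)"
    then have \<mu>a: "\<mu> \<in> arr \<Lambda>" by (auto simp: paths_at_def)
    have Fa: "F \<subseteq> arr \<Lambda>" using bar_step.hyps by (auto simp: paths_at_def)
    obtain e where e: "e \<in> E" "Lambda_min \<Lambda> \<mu> e \<noteq> {}"
      using E \<mu> unfolding exhaustive_def by blast
    have ea: "e \<in> arr \<Lambda>" using e bar_step.hyps by (auto simp: paths_at_def)
    obtain \<tau> where \<tau>: "\<mu> \<preceq> \<tau>" "e \<preceq> \<tau>"
      using e \<mu>a ea Lambda_min_nonempty_iff by blast
    from \<tau>(2) obtain \<beta> where \<beta>: "\<beta> \<in> arr \<Lambda>" "src \<Lambda> e = rng \<Lambda> \<beta>" "\<tau> = e \<cdot> \<beta>" by (rule prefixE)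
    obtain g where g: "g \<in> Ext \<Lambda> e F" "Lambda_min \<Lambda> \<beta> g \<noteq> {}"
      using bar_step.IH[OF e(1)] \<beta> unfolding exhaustive_def paths_at_def by fastforce
    have ga: "g \<in> arr \<Lambda>" "src \<Lambda> e = rng \<Lambda> g" using g by (auto simp: Ext_def paths_at_def)
    obtain \<sigma> where \<sigma>: "\<beta> \<preceq> \<sigma>" "g \<preceq> \<sigma>" using g \<beta> ga Lambda_min_nonempty_iff by blast
    obtain f where f: "f \<in> F" "f \<preceq> e \<cdot> g" using g(1) Fa ea by (auto simp: Ext_iff)
    have "f \<preceq> e \<cdot> \<sigma>" using prefix_trans f prefix_comp_mono[OF \<sigma>(2) ea ga(2)] by blast
    moreover have "\<mu> \<preceq> e \<cdot> \<sigma>"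
      using prefix_trans \<tau>(1) prefix_comp_mono[OF \<sigma>(1) ea \<beta>(2)] \<beta>(3) by blast
    ultimately show "\<exists>\<nu>\<in>F. Lambda_min \<Lambda> \<mu> \<nu> \<noteq> {}"
      using f Fa \<mu>a Lambda_min_nonempty_iff by (meson subsetD)
  qed
qed

lemma bars_iff:
  assumes "\<E> \<subseteq> FE \<Lambda>"
  shows "F \<in> bars \<E> \<longleftrightarrow> F \<in> FE \<Lambda> \<and> bar \<E> (range_vertex \<Lambda> F) F"
proof
  assume "F \<in> bars \<E>"
  then obtain v where v: "bar \<E> v F" "v \<notin> F" by (auto simp: bars_def)
  note d = barD[OF v(1)]
  have "F \<in> FE \<Lambda>" using v d bar_exhaustive[OF v(1) assms] by (auto simp: FE_iff)
  then show "F \<in> FE \<Lambda> \<and> bar \<E> (range_vertex \<Lambda> F) F"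
    using v d range_vertex_subset by metis
next
  assume "F \<in> FE \<Lambda> \<and> bar \<E> (range_vertex \<Lambda> F) F"
  then show "F \<in> bars \<E>" using FE_cases(3) by (auto simp: bars_def)
qed

lemma barsI: "bar \<E> v F \<Longrightarrow> v \<notin> F \<Longrightarrow> F \<in> bars \<E>"
  by (auto simp: bars_def)

lemma efficientD:
  assumes "efficient \<Lambda> \<E>"
  shows "\<E> \<subseteq> FE_edges \<Lambda>" "\<E> \<subseteq> FE \<Lambda>"
    "\<And>E F. \<lbrakk>E \<in> \<E>; F \<in> \<E>; E \<subseteq> F\<rbrakk> \<Longrightarrow> E = F"
    "\<And>E f. \<lbrakk>E \<in> \<E>; f \<in> edges \<Lambda>; rng \<Lambda> f = range_vertex \<Lambda> E; f \<notin> E\<rbrakk> \<Longrightarrow> \<exists>F \<in> \<E>. F \<subseteq> Ext \<Lambda> f E"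
    "\<And>E e F. \<lbrakk>E \<in> \<E>; e \<in> E; F \<in> \<E>; range_vertex \<Lambda> F = src \<Lambda> e\<rbrakk>
      \<Longrightarrow> \<exists>G \<in> \<E>. G \<subseteq> (E - {e}) \<union> {initial \<Lambda> (e \<cdot> f) (deg \<Lambda> f) | f. f \<in> F}"
proof -
  note eff = assms[unfolded efficient_def]
  note E1 = eff[THEN conjunct2, THEN conjunct1]
  note E2 = eff[THEN conjunct2, THEN conjunct2, THEN conjunct1]
  note E3 = eff[THEN conjunct2, THEN conjunct2, THEN conjunct2]
  show "\<E> \<subseteq> FE_edges \<Lambda>" by (rule eff[THEN conjunct1])
  then show "\<E> \<subseteq> FE \<Lambda>" using FE_edgesD by blast
  show "E = F" if "E \<in> \<E>" "F \<in> \<E>" "E \<subseteq> F" for E F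
    by (rule E1[rule_format, OF that])
  show "\<exists>F \<in> \<E>. F \<subseteq> Ext \<Lambda> f E"
    if "E \<in> \<E>" "f \<in> edges \<Lambda>" "rng \<Lambda> f = range_vertex \<Lambda> E" "f \<notin> E" for E f
    by (rule E2[rule_format]) (use that in \<open>auto simp: paths_at_def\<close>)
  show "\<exists>G \<in> \<E>. G \<subseteq> (E - {e}) \<union> {initial \<Lambda> (e \<cdot> f) (deg \<Lambda> f) | f. f \<in> F}"
    if "E \<in> \<E>" "e \<in> E" "F \<in> \<E>" "range_vertex \<Lambda> F = src \<Lambda> e" for E e F
    by (rule E3[rule_format]) (use that in \<open>auto simp: sets_at_def\<close>)
qed

end

section \<open>Stability of bars under extension, cutting and refinement\<close>

context finitely_aligned_k_graph
begin

text \<open>This is where finite alignment enters: each member of \<open>Ext\<close> is the first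
  component of a pair in one of finitely many sets \<open>Lambda_min\<close>.\<close>

lemma finite_Ext:
  assumes "\<mu> \<in> arr \<Lambda>" "finite E" "E \<subseteq> arr \<Lambda>"
  shows "finite (Ext \<Lambda> \<mu> E)"
proof (rule finite_subset)
  show "Ext \<Lambda> \<mu> E \<subseteq> (\<Union>e\<in>E. fst ` Lambda_min \<Lambda> \<mu> e)"
  proof
    fix g assume "g \<in> Ext \<Lambda> \<mu> E"
    then obtain e where g: "g \<in> arr \<Lambda>" "rng \<Lambda> g = src \<Lambda> \<mu>" and e: "e \<in> E" "\<mu> \<cdot> g \<in> MCE \<Lambda> \<mu> e"
      by (auto simp: Ext_def paths_at_def)
    then have "e \<preceq> \<mu> \<cdot> g" using assms MCE_iff by blast
    then obtain \<beta> where "\<beta> \<in> arr \<Lambda>" "src \<Lambda> e = rng \<Lambda> \<beta>" "\<mu> \<cdot> g = e \<cdot> \<beta>" by (rule prefixE)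
    then have "(g, \<beta>) \<in> Lambda_min \<Lambda> \<mu> e" using g e by (auto simp: Lambda_min_def)
    then show "g \<in> (\<Union>e\<in>E. fst ` Lambda_min \<Lambda> \<mu> e)" using e by force
  qed
  show "finite (\<Union>e\<in>E. fst ` Lambda_min \<Lambda> \<mu> e)"
    using assms finite_Lambda_min by auto
qed

text \<open>By \<open>src_in_Ext_iff\<close> the set contains its own vertex, so the recursion stops
  at once.\<close>

lemma bar_Ext_prefix:
  assumes "finite F" "F \<subseteq> arr \<Lambda>" "\<mu> \<in> arr \<Lambda>" "f \<in> F" "f \<preceq> \<mu>"
  shows "bar \<E> (src \<Lambda> \<mu>) (Ext \<Lambda> \<mu> F)"
  using assms src_in_Ext_iff[OF assms(3,2)]
  by (intro bar_vertex src_vertex finite_Ext Ext_paths_at) auto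

text \<open>If f is in the set \<open>E\<close> of the last step, the claim is a premise of that
  step. Otherwise (E2) supplies \<open>G\<close> inside \<open>Ext \<Lambda> f E\<close>, and every
  g in \<open>G\<close> closes a square fg = eh with e in \<open>E\<close>. The iterated extensions
  along the two sides of the square agree, and the induction hypothesis for e applies to the
  opposite edge h.\<close>

lemma bar_Ext_edge:
  assumes "bar \<E> v F" "efficient \<Lambda> \<E>" "f \<in> edges \<Lambda>" "rng \<Lambda> f = v"
  shows "bar \<E> (src \<Lambda> f) (Ext \<Lambda> f F)"
  using assms(1,3,4)
proof (induction arbitrary: f)
  case (bar_vertex v F)
  have f: "f \<in> arr \<Lambda>" using bar_vertex edge_arr by auto
  moreover have "F \<subseteq> arr \<Lambda>" using bar_vertex by (auto simp: paths_at_def)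
  ultimately show ?case
    using bar_vertex bar_Ext_prefix rng_prefix[OF f] by blast
next
  case (bar_step v F E)
  note eff = efficientD[OF assms(2)]
  have f: "f \<in> arr \<Lambda>" using bar_step.prems edge_arr by auto
  have Fa: "F \<subseteq> arr \<Lambda>" and Ea: "E \<subseteq> arr \<Lambda>" using bar_step.hyps by (auto simp: paths_at_def)
  have rE: "range_vertex \<Lambda> E = v" using bar_step.hyps eff(2) range_vertex_subset by blast
  show ?case
  proof (cases "f \<in> E")
    case True
    then show ?thesis using bar_step by blast
  next
    case False
    obtain G where G: "G \<in> \<E>" "G \<subseteq> Ext \<Lambda> f E"
      using eff(4)[OF bar_step.hyps(4) bar_step.prems(1)] False bar_step.prems rE by auto
    have Ee: "E \<subseteq> edges \<Lambda>" using eff(1) bar_step.hyps FE_edgesD by blast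
    show ?thesis
    proof (rule bar.bar_step[OF src_vertex finite_Ext Ext_paths_at G(1)])
      show "G \<subseteq> paths_at \<Lambda> (src \<Lambda> f) (arr \<Lambda>)" using G Ext_paths_at by blast
      fix g assume "g \<in> G"
      then have gX: "g \<in> Ext \<Lambda> f E" using G by auto
      then obtain e where e: "e \<in> E" "deg \<Lambda> g = deg \<Lambda> e" "e \<preceq> f \<cdot> g" "g \<in> edges \<Lambda>"
        using Ext_edges[OF bar_step.prems(1) False Ee] by metis
      have g: "g \<in> arr \<Lambda>" "src \<Lambda> f = rng \<Lambda> g" using gX by (auto simp: Ext_def paths_at_def)
      have ea: "e \<in> arr \<Lambda>" using e Ea by auto
      obtain h where h: "h \<in> arr \<Lambda>" "src \<Lambda> e = rng \<Lambda> h" "f \<cdot> g = e \<cdot> h" using e(3) by (rule prefixE)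
      have "deg \<Lambda> f + deg \<Lambda> g = deg \<Lambda> e + deg \<Lambda> h"
        using f g ea h by (metis deg_comp)
      \<comment> \<open>Opposite sides of the square have equal degree. So h is an edge, as the
        induction hypothesis demands.\<close>
      then have "deg \<Lambda> h = deg \<Lambda> f" using e(2) by (simp add: add.commute)
      then have he: "h \<in> edges \<Lambda>" using edgeI h bar_step.prems by blast
      have "Ext \<Lambda> g (Ext \<Lambda> f F) = Ext \<Lambda> h (Ext \<Lambda> e F)"
        using Ext_comp[OF f g Fa] Ext_comp[OF ea h(1,2) Fa] h(3) by simp
      moreover have "src \<Lambda> g = src \<Lambda> h"
        using f g ea h by (metis src_comp)
      ultimately show "bar \<E> (src \<Lambda> g) (Ext \<Lambda> g (Ext \<Lambda> f F))"
        using bar_step.IH[OF e(1) he] h(2) by simp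
    qed (use f Fa bar_step.hyps in auto)
  qed
qed

lemma bar_Ext:
  assumes "\<mu> \<in> arr \<Lambda>" "efficient \<Lambda> \<E>" "bar \<E> (rng \<Lambda> \<mu>) F"
  shows "bar \<E> (src \<Lambda> \<mu>) (Ext \<Lambda> \<mu> F)"
  using assms(1,3)
proof (induction arbitrary: F rule: path_induct)
  case (vertex v)
  then show ?case using vertex_simps[of v] Ext_vertex barD(3) by metis
next
  case (edge e \<nu>)
  have e: "e \<in> arr \<Lambda>" using edge edge_arr by auto
  have "bar \<E> (rng \<Lambda> e) F" using edge e by (simp add: rng_comp)
  then have "bar \<E> (src \<Lambda> e) (Ext \<Lambda> e F)"
    using bar_Ext_edge[OF _ assms(2) edge.hyps(1) refl] by blast
  then have "bar \<E> (src \<Lambda> \<nu>) (Ext \<Lambda> \<nu> (Ext \<Lambda> e F))" using edge.IH edge.hyps(3) by simp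
  then show ?case using Ext_comp edge e barD(4)[OF edge.prems] by (simp add: src_comp)
qed

text \<open>The hypothesis passes from \<open>F\<close> to \<open>Ext \<Lambda> e F\<close>: a
  member g of the latter satisfies eg = fh for some f in \<open>F\<close>, so extending F' along e
  and g is the same as extending it along f and h. The first of these gives a bar by assumption, the
  second preserves it by \<open>bar_Ext\<close>.\<close>

lemma bar_cut:
  assumes "bar \<E> v F" "efficient \<Lambda> \<E>" "finite F'" "F' \<subseteq> paths_at \<Lambda> v (arr \<Lambda>)"
    and "\<And>\<mu>. \<mu> \<in> F \<Longrightarrow> bar \<E> (src \<Lambda> \<mu>) (Ext \<Lambda> \<mu> F')"
  shows "bar \<E> v F'"
  using assms(1,3-)
proof (induction arbitrary: F')
  case (bar_vertex v F)
  then show ?case using Ext_vertex vertex_simps(3) by metis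
next
  case (bar_step v F E)
  have Fa: "F \<subseteq> arr \<Lambda>" and Fa': "F' \<subseteq> arr \<Lambda>" and Ea: "E \<subseteq> arr \<Lambda>"
    using bar_step.hyps bar_step.prems by (auto simp: paths_at_def)
  show ?case
  proof (rule bar.bar_step[OF bar_step.hyps(1) bar_step.prems(1,2) bar_step.hyps(4,5)])
    fix e assume e: "e \<in> E"
    then have ea: "e \<in> arr \<Lambda>" using Ea by auto
    show "bar \<E> (src \<Lambda> e) (Ext \<Lambda> e F')"
    proof (rule bar_step.IH[OF e finite_Ext[OF ea bar_step.prems(1) Fa'] Ext_paths_at])
      fix g assume gX: "g \<in> Ext \<Lambda> e F"
      then have g: "g \<in> arr \<Lambda>" "src \<Lambda> e = rng \<Lambda> g" by (auto simp: Ext_def paths_at_def)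
      obtain f where f: "f \<in> F" "f \<preceq> e \<cdot> g" using gX Fa ea by (auto simp: Ext_iff)
      have fa: "f \<in> arr \<Lambda>" using f Fa by auto
      obtain h where h: "h \<in> arr \<Lambda>" "src \<Lambda> f = rng \<Lambda> h" "e \<cdot> g = f \<cdot> h" using f(2) by (rule prefixE)
      have "bar \<E> (src \<Lambda> h) (Ext \<Lambda> h (Ext \<Lambda> f F'))"
        using bar_Ext[OF h(1) assms(2)] bar_step.prems(3)[OF f(1)] h(2) by simp
      moreover have "Ext \<Lambda> g (Ext \<Lambda> e F') = Ext \<Lambda> h (Ext \<Lambda> f F')"
        using Ext_comp[OF ea g Fa'] Ext_comp[OF fa h(1,2) Fa'] h(3) by simp
      moreover have "src \<Lambda> g = src \<Lambda> h" using ea g fa h by (metis src_comp)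
      ultimately show "bar \<E> (src \<Lambda> g) (Ext \<Lambda> g (Ext \<Lambda> e F'))" by simp
    qed
  qed
qed

text \<open>The case of \<open>bar_cut\<close> in which every \<open>Ext \<Lambda> \<mu> F'\<close>
  contains its vertex. It covers both enlarging a bar and truncating its members.\<close>

lemma bar_refine:
  assumes "bar \<E> v F" "efficient \<Lambda> \<E>" "finite F'" "F' \<subseteq> paths_at \<Lambda> v (arr \<Lambda>)"
    and "\<And>\<mu>. \<mu> \<in> F \<Longrightarrow> \<exists>f\<in>F'. f \<preceq> \<mu>"
  shows "bar \<E> v F'"
proof (rule bar_cut[OF assms(1-4)])
  fix \<mu> assume "\<mu> \<in> F"
  moreover have "F' \<subseteq> arr \<Lambda>" using assms by (auto simp: paths_at_def)
  ultimately show "bar \<E> (src \<Lambda> \<mu>) (Ext \<Lambda> \<mu> F')"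
    using bar_Ext_prefix assms(3,5) prefix_arr(2) by metis
qed

lemma bar_self:
  assumes "E \<in> \<E>" "\<E> \<subseteq> FE \<Lambda>"
  shows "bar \<E> (range_vertex \<Lambda> E) E"
proof -
  have "E \<in> FE \<Lambda>" using assms by auto
  note E = FE_cases[OF this]
  show ?thesis
    using bar_step[OF E(2,1,4) assms(1) E(4)] bar_Ext_prefix[OF E(1,6)] prefix_refl E(6) by blast
qed

text \<open>(S1) and (S3) come from \<open>bar_refine\<close>, (S2) from \<open>bar_Ext\<close> and
  (S4) from \<open>bar_cut\<close>. In each case it remains to see that the new set avoids its
  vertex.\<close>

lemma satiated_bars:
  assumes eff: "efficient \<Lambda> \<E>"
  shows "satiated \<Lambda> (bars \<E>)"
proof -
  note EF = efficientD(2)[OF eff]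
  note iff = bars_iff[OF EF]
  show ?thesis
    unfolding satiated_def
  proof (intro conjI allI ballI impI)
    show "bars \<E> \<subseteq> FE \<Lambda>" using iff by auto
  next
    fix E F assume E: "E \<in> bars \<E>" and F: "F \<in> FE \<Lambda>" and sub: "E \<subseteq> F"
    note Fc = FE_cases[OF F]
    have "range_vertex \<Lambda> E = range_vertex \<Lambda> F"
      using E iff range_vertex_subset Fc sub by blast
    then have "bar \<E> (range_vertex \<Lambda> F) F"
      using E iff bar_refine[OF _ eff Fc(1,4)] sub prefix_refl Fc(6) by (metis subsetD)
    then show "F \<in> bars \<E>" using F iff by auto
  next
    fix E \<mu> assume E: "E \<in> bars \<E>"
      and "\<mu> \<in> paths_at \<Lambda> (range_vertex \<Lambda> E) (arr \<Lambda>) - right_extensions \<Lambda> E"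
    then have \<mu>: "\<mu> \<in> arr \<Lambda>" "rng \<Lambda> \<mu> = range_vertex \<Lambda> E" "\<mu> \<notin> right_extensions \<Lambda> E"
      by (auto simp: paths_at_def)
    have b: "bar \<E> (range_vertex \<Lambda> E) E" using E iff by auto
    then have "bar \<E> (src \<Lambda> \<mu>) (Ext \<Lambda> \<mu> E)" using bar_Ext[OF \<mu>(1) eff] \<mu>(2) by simp
    moreover have "src \<Lambda> \<mu> \<notin> Ext \<Lambda> \<mu> E"
      using \<mu> src_in_Ext_iff[OF \<mu>(1) barD(4)[OF b]] by (auto simp: prefix_def right_extensions_def)
    ultimately show "Ext \<Lambda> \<mu> E \<in> bars \<E>" by (rule barsI)
  next
    fix E n assume E: "E \<in> bars \<E>" and n: "\<forall>\<mu>\<in>E. n \<mu> \<noteq> 0 \<and> n \<mu> \<le> deg \<Lambda> \<mu>"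
    let ?F = "(\<lambda>\<mu>. initial \<Lambda> \<mu> (n \<mu>)) ` E" and ?v = "range_vertex \<Lambda> E"
    have "E \<in> FE \<Lambda>" and b: "bar \<E> ?v E" using E iff by auto
    note Ec = FE_cases[OF this(1)]
    have p: "initial \<Lambda> \<mu> (n \<mu>) \<preceq> \<mu>" "deg \<Lambda> (initial \<Lambda> \<mu> (n \<mu>)) = n \<mu>" if "\<mu> \<in> E" for \<mu>
      using initial_prefix that n Ec(6) by auto
    have "bar \<E> ?v ?F"
    proof (rule bar_refine[OF b eff])
      show "?F \<subseteq> paths_at \<Lambda> ?v (arr \<Lambda>)"
        using p Ec(4) prefix_arr prefix_rng by (fastforce simp: paths_at_def)
      show "\<exists>f\<in>?F. f \<preceq> \<mu>" if "\<mu> \<in> E" for \<mu> using p(1) that by blast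
    qed (use Ec(1) in simp)
    moreover have "?v \<notin> ?F" using p(2) n vertex_simps(4)[OF Ec(2)] by (metis (no_types, lifting) imageE)
    ultimately show "?F \<in> bars \<E>" by (rule barsI)
  next
    fix E E' X assume E: "E \<in> bars \<E>" and E': "E' \<subseteq> E"
      and X: "\<forall>\<mu>\<in>E'. X \<mu> \<in> sets_at \<Lambda> (src \<Lambda> \<mu>) (bars \<E>)"
    let ?F = "(E - E') \<union> (\<Union>\<mu>\<in>E'. comp \<Lambda> \<mu> ` X \<mu>)" and ?v = "range_vertex \<Lambda> E"
    have "E \<in> FE \<Lambda>" and b: "bar \<E> ?v E" using E iff by auto
    note Ec = FE_cases[OF this(1)]
    have X: "bar \<E> (src \<Lambda> \<mu>) (X \<mu>)" if "\<mu> \<in> E'" for \<mu>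
      using X that iff by (auto simp: sets_at_def)
    have Xa: "x \<in> arr \<Lambda>" "src \<Lambda> \<mu> = rng \<Lambda> x" "\<mu> \<in> arr \<Lambda>" "rng \<Lambda> \<mu> = ?v"
      if "\<mu> \<in> E'" "x \<in> X \<mu>" for \<mu> x
      using barD(3)[OF X[OF that(1)]] that E' Ec by (auto simp: paths_at_def)
    have fin: "finite ?F" using Ec(1) finite_subset[OF E'] barD(2)[OF X] by simp
    have at: "?F \<subseteq> paths_at \<Lambda> ?v (arr \<Lambda>)"
      using Ec(4) Xa by (auto simp: paths_at_def comp_arr rng_comp)
    then have Fa: "?F \<subseteq> arr \<Lambda>" by (auto simp: paths_at_def)
    have "bar \<E> ?v ?F"
    proof (rule bar_cut[OF b eff fin at])
      fix \<mu> assume \<mu>: "\<mu> \<in> E"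
      then have \<mu>a: "\<mu> \<in> arr \<Lambda>" using Ec by auto
      \<comment> \<open>If something was grafted at \<mu>, then
        \<open>Ext \<Lambda> \<mu> ?F\<close> contains the bar \<open>X \<mu>\<close>; if not, \<mu>
        itself belongs to \<open>?F\<close>.\<close>
      show "bar \<E> (src \<Lambda> \<mu>) (Ext \<Lambda> \<mu> ?F)"
      proof (cases "\<mu> \<in> E'")
        case True
        show ?thesis
        proof (rule bar_refine[OF X[OF True] eff finite_Ext[OF \<mu>a fin Fa] Ext_paths_at])
          fix x assume x: "x \<in> X \<mu>"
          then have "x \<in> Ext \<Lambda> \<mu> ?F"
            using mem_Ext_comp[OF \<mu>a Xa(1,2)[OF True x] _ Fa] True by blast
          then show "\<exists>f\<in>Ext \<Lambda> \<mu> ?F. f \<preceq> x" using prefix_refl Xa[OF True x] by blast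
        qed
      next
        case False
        then show ?thesis using bar_Ext_prefix[OF fin Fa \<mu>a _ prefix_refl[OF \<mu>a]] \<mu> by blast
      qed
    qed
    moreover have "?v \<notin> ?F"
    proof
      assume "?v \<in> ?F"
      then obtain \<mu> x where \<mu>: "\<mu> \<in> E'" "x \<in> X \<mu>" "?v = \<mu> \<cdot> x" using Ec(3) by auto
      then have "deg \<Lambda> \<mu> + deg \<Lambda> x = 0"
        using Xa[OF \<mu>(1,2)] vertex_simps(4)[OF Ec(2)] by (metis deg_comp)
      then have "deg \<Lambda> \<mu> = 0" by (auto simp: fun_eq_iff)
      then show False using deg_nonzero[OF Ec(2,4,3)] \<mu> E' by auto
    qed
    ultimately show "?F \<in> bars \<E>" by (rule barsI)
  qed
qed

end

section \<open>Bars and satiated collections\<close>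

lemma min_sets_below:
  assumes "E \<in> \<G>" "finite E"
  obtains M where "M \<in> min_sets \<G>" "M \<subseteq> E"
proof -
  have "\<exists>M\<in>min_sets \<G>. M \<subseteq> E"
    using assms(2,1)
  proof (induction E rule: finite_psubset_induct)
    case (psubset E)
    show ?case
    proof (cases "E \<in> min_sets \<G>")
      case False
      then obtain F where F: "F \<in> \<G>" "F \<subset> E" using psubset.prems by (auto simp: min_sets_def)
      obtain M where "M \<in> min_sets \<G>" "M \<subseteq> F" using psubset.IH[OF F(2,1)] by auto
      then show ?thesis using F(2) by (intro bexI[of _ M]) auto
    qed blast
  qed
  then show thesis using that by blast
qed

section \<open>Bars lie in every satiated collection, and edge bars contain members of \<E>\<close>

context finitely_aligned_k_graph
begin

lemma satiatedD:
  assumes "satiated \<Lambda> \<G>"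
  shows "\<G> \<subseteq> FE \<Lambda>" "\<And>E F. \<lbrakk>E \<in> \<G>; F \<in> FE \<Lambda>; E \<subseteq> F\<rbrakk> \<Longrightarrow> F \<in> \<G>"
    "\<And>E \<mu>. \<lbrakk>E \<in> \<G>; \<mu> \<in> arr \<Lambda>; rng \<Lambda> \<mu> = range_vertex \<Lambda> E; \<not> (\<exists>f\<in>E. f \<preceq> \<mu>)\<rbrakk> \<Longrightarrow> Ext \<Lambda> \<mu> E \<in> \<G>"
    "\<And>E n. \<lbrakk>E \<in> \<G>; \<And>\<mu>. \<mu> \<in> E \<Longrightarrow> n \<mu> \<noteq> 0 \<and> n \<mu> \<le> deg \<Lambda> \<mu>\<rbrakk> \<Longrightarrow> (\<lambda>\<mu>. initial \<Lambda> \<mu> (n \<mu>)) ` E \<in> \<G>"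
    "\<And>E E' X. \<lbrakk>E \<in> \<G>; E' \<subseteq> E; \<And>\<mu>. \<mu> \<in> E' \<Longrightarrow> X \<mu> \<in> \<G> \<and> range_vertex \<Lambda> (X \<mu>) = src \<Lambda> \<mu>\<rbrakk>
      \<Longrightarrow> (E - E') \<union> (\<Union>\<mu> \<in> E'. comp \<Lambda> \<mu> ` X \<mu>) \<in> \<G>"
proof -
  note sat = assms[unfolded satiated_def]
  note S1 = sat[THEN conjunct2, THEN conjunct1]
  note S2 = sat[THEN conjunct2, THEN conjunct2, THEN conjunct1]
  note S3 = sat[THEN conjunct2, THEN conjunct2, THEN conjunct2, THEN conjunct1]
  note S4 = sat[THEN conjunct2, THEN conjunct2, THEN conjunct2, THEN conjunct2]
  show sub: "\<G> \<subseteq> FE \<Lambda>" by (rule sat[THEN conjunct1])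
  show "F \<in> \<G>" if "E \<in> \<G>" "F \<in> FE \<Lambda>" "E \<subseteq> F" for E F
    by (rule S1[rule_format, OF that])
  show "Ext \<Lambda> \<mu> E \<in> \<G>"
    if "E \<in> \<G>" "\<mu> \<in> arr \<Lambda>" "rng \<Lambda> \<mu> = range_vertex \<Lambda> E" "\<not> (\<exists>f\<in>E. f \<preceq> \<mu>)" for E \<mu>
  proof -
    have "E \<subseteq> arr \<Lambda>" using that(1) sub FE_cases(6) by blast
    then have "\<mu> \<notin> right_extensions \<Lambda> E" using that(4) by (auto simp: right_extensions_def prefix_def)
    then show ?thesis using that by (intro S2[rule_format]) (auto simp: paths_at_def)
  qed
  show "(\<lambda>\<mu>. initial \<Lambda> \<mu> (n \<mu>)) ` E \<in> \<G>"
    if "E \<in> \<G>" "\<And>\<mu>. \<mu> \<in> E \<Longrightarrow> n \<mu> \<noteq> 0 \<and> n \<mu> \<le> deg \<Lambda> \<mu>" for E n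
    by (rule S3[rule_format, OF that])
  show "(E - E') \<union> (\<Union>\<mu> \<in> E'. comp \<Lambda> \<mu> ` X \<mu>) \<in> \<G>"
    if "E \<in> \<G>" "E' \<subseteq> E" "\<And>\<mu>. \<mu> \<in> E' \<Longrightarrow> X \<mu> \<in> \<G> \<and> range_vertex \<Lambda> (X \<mu>) = src \<Lambda> \<mu>" for E E' X
    by (rule S4[rule_format, OF that(1,2)]) (use that(3) in \<open>simp add: sets_at_def\<close>)
qed

text \<open>By (S4), \<open>Ext \<Lambda> e F\<close> is grafted onto each e in
  \<open>E - F\<close>; edges already in \<open>F\<close> stay, since there the extension contains
  its vertex. Every path of the result has a prefix in \<open>F\<close>, so (S3) truncates it into
  \<open>F\<close>, and (S1) enlarges the truncated set to \<open>F\<close>.\<close>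

lemma bar_satiated:
  assumes "bar \<E> v F" "satiated \<Lambda> \<G>" "\<E> \<subseteq> \<G>" "\<E> \<subseteq> FE_edges \<Lambda>"
  shows "v \<in> F \<or> F \<in> \<G>"
  using assms(1)
proof induction
  case (bar_vertex v F)
  then show ?case by simp
next
  case (bar_step v F E)
  note sat = satiatedD[OF assms(2)]
  have EF: "\<E> \<subseteq> FE \<Lambda>" using assms(4) FE_edgesD by blast
  have E: "E \<in> \<G>" "E \<in> FE \<Lambda>" "E \<subseteq> edges \<Lambda>" using bar_step.hyps assms(3,4) FE_edgesD by blast+
  have Fa: "F \<subseteq> arr \<Lambda>" using bar_step.hyps by (auto simp: paths_at_def)
  have bF: "bar \<E> v F" using bar_step.hyps by (rule bar.bar_step)
  show ?case
  proof (cases "v \<in> F")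
    case v: False
    then have F: "F \<in> FE \<Lambda>" using bF bars_iff[OF EF] barsI by blast
    have X: "Ext \<Lambda> e F \<in> \<G> \<and> range_vertex \<Lambda> (Ext \<Lambda> e F) = src \<Lambda> e" if e: "e \<in> E - F" for e
    proof -
      have ee: "e \<in> edges \<Lambda>" "e \<in> arr \<Lambda>" using e E edge_arr by auto
      have "\<not> (\<exists>f\<in>F. f \<preceq> e)"
        using edge_prefix_iff[OF bar_step.hyps(1,3) v ee(1)] e by simp
      then have "src \<Lambda> e \<notin> Ext \<Lambda> e F" using src_in_Ext_iff[OF ee(2) Fa] by simp
      then have "Ext \<Lambda> e F \<in> \<G>" using bar_step.IH e by blast
      then show ?thesis
        using range_vertex_subset[OF _ src_vertex[OF ee(2)] Ext_paths_at] sat(1) by blast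
    qed
    let ?H = "(E - (E - F)) \<union> (\<Union>e\<in>E - F. comp \<Lambda> e ` Ext \<Lambda> e F)"
    have H: "?H \<in> \<G>" by (rule sat(5)[OF E(1) _ X]) auto
    have "\<exists>f\<in>F. f \<preceq> h" if h: "h \<in> ?H" for h
    proof (cases "h \<in> E \<inter> F")
      case True then show ?thesis using prefix_refl Fa by blast
    next
      case False
      then obtain e g where "e \<in> E" "g \<in> Ext \<Lambda> e F" "h = e \<cdot> g" using h by blast
      then show ?thesis using E edge_arr Fa Ext_iff by (metis subsetD)
    qed
    \<comment> \<open>The degree of \<open>\<phi> h\<close> is the truncation level for (S3); it is
      nonzero because \<open>F\<close> avoids \<open>v\<close>.\<close>
    then obtain \<phi> where \<phi>: "\<And>h. h \<in> ?H \<Longrightarrow> \<phi> h \<in> F \<and> \<phi> h \<preceq> h" by metis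
    have "(\<lambda>h. initial \<Lambda> h (deg \<Lambda> (\<phi> h))) ` ?H \<in> \<G>"
    proof (rule sat(4)[OF H])
      fix h assume "h \<in> ?H"
      from \<phi>[OF this] show "deg \<Lambda> (\<phi> h) \<noteq> 0 \<and> deg \<Lambda> (\<phi> h) \<le> deg \<Lambda> h"
        using prefix_deg_le[of "\<phi> h" h] deg_nonzero[OF bar_step.hyps(1,3) v] by simp
    qed
    moreover have "(\<lambda>h. initial \<Lambda> h (deg \<Lambda> (\<phi> h))) ` ?H \<subseteq> F"
    proof (rule image_subsetI)
      fix h assume "h \<in> ?H"
      from \<phi>[OF this] show "initial \<Lambda> h (deg \<Lambda> (\<phi> h)) \<in> F" by (simp add: initial_eq)
    qed
    ultimately show ?thesis using sat(2) F by blast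
  qed simp
qed

text \<open>For e in \<open>E - F\<close> the set \<open>Ext \<Lambda> e F\<close> again consists of
  edges, so by induction it contains some \<open>G\<close> in \<E>. Then (E3) trades e for edges of
  \<open>F\<close>, and finitely many such trades move \<open>E\<close> into
  \<open>F\<close>.\<close>

lemma bar_edges_contains:
  assumes "bar \<E> v F" "efficient \<Lambda> \<E>" "F \<subseteq> edges \<Lambda>"
  shows "\<exists>E\<in>\<E>. E \<subseteq> F"
  using assms(1,3)
proof induction
  case (bar_vertex v F)
  then show ?case using vertex_simps(4) edge_deg_nonzero by blast
next
  case (bar_step v F E)
  note eff = efficientD[OF assms(2)]
  have Ee: "E \<subseteq> edges \<Lambda>" using bar_step.hyps eff(1) FE_edgesD by blast
  have Fa: "F \<subseteq> arr \<Lambda>" using bar_step.hyps by (auto simp: paths_at_def)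
  have replace: "\<exists>G\<in>\<E>. G \<subseteq> Ext \<Lambda> e F" if "e \<in> E" "e \<notin> F" for e
    using bar_step.IH[OF that(1)] Ext_edges[OF _ that(2) bar_step.prems] Ee that(1) by blast
  \<comment> \<open>A trade may yield any member of \<E> below the traded set, hence the
    generalisation from \<open>E\<close> to all such \<open>H\<close>. The number of edges outside
    \<open>F\<close> drops each time.\<close>
  have "\<exists>K\<in>\<E>. K \<subseteq> F" if "H \<in> \<E>" "H \<subseteq> E \<union> F" for H
    using that
  proof (induction "card (H - F)" arbitrary: H rule: less_induct)
    case less
    show ?case
    proof (cases "H \<subseteq> F")
      case True then show ?thesis using less by blast
    next
      case False
      then obtain e where e: "e \<in> H" "e \<notin> F" "e \<in> E" using less by blast
      have ea: "e \<in> arr \<Lambda>" using e Ee edge_arr by blast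
      obtain G where G: "G \<in> \<E>" "G \<subseteq> Ext \<Lambda> e F" using replace e by blast
      have "range_vertex \<Lambda> G = src \<Lambda> e"
        using G eff(2) by (intro range_vertex_subset[OF _ src_vertex[OF ea]]) (use Ext_paths_at in blast)+
      then obtain K where K: "K \<in> \<E>" "K \<subseteq> (H - {e}) \<union> {initial \<Lambda> (e \<cdot> g) (deg \<Lambda> g) | g. g \<in> G}"
        using eff(5)[OF less.prems(1) e(1) G(1)] by blast
      have "initial \<Lambda> (e \<cdot> g) (deg \<Lambda> g) \<in> F" if "g \<in> G" for g
      proof -
        obtain f where "f \<in> F" "deg \<Lambda> g = deg \<Lambda> f" "f \<preceq> e \<cdot> g"
          using Ext_edges[OF _ e(2) bar_step.prems] Ee e(3) G(2) \<open>g \<in> G\<close> by (metis subsetD)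
        then show ?thesis using initial_eq[of f "e \<cdot> g"] by simp
      qed
      then have "{initial \<Lambda> (e \<cdot> g) (deg \<Lambda> g) | g. g \<in> G} \<subseteq> F" by auto
      then have KF: "K \<subseteq> (H - {e}) \<union> F" using K(2) by (meson Un_mono order_refl order_trans)
      have "finite H" using less.prems eff(2) FE_cases(1) by blast
      then have "card (K - F) < card (H - F)" using KF e by (intro psubset_card_mono) auto
      then show ?thesis using less KF K(1) by blast
    qed
  qed
  then show ?case using bar_step.hyps by blast
qed

text \<open>Every edge bar contains a member of \<E>, and the members are edge bars themselves, so
  minimal edge bars belong to \<E>. Conversely, (E1) makes every member minimal.\<close>

lemma min_sets_bars:
  assumes eff: "efficient \<Lambda> \<E>"
  shows "min_sets (bars \<E> \<inter> FE_edges \<Lambda>) = \<E>"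
proof -
  note E = efficientD[OF eff]
  have sub: "\<E> \<subseteq> bars \<E> \<inter> FE_edges \<Lambda>"
    using bar_self[OF _ E(2)] bars_iff[OF E(2)] E(1,2) by blast
  have below: "\<exists>E\<in>\<E>. E \<subseteq> F" if "F \<in> bars \<E> \<inter> FE_edges \<Lambda>" for F
    using that bar_edges_contains[OF _ eff] FE_edgesD by (auto simp: bars_def)
  show ?thesis
  proof
    show "min_sets (bars \<E> \<inter> FE_edges \<Lambda>) \<subseteq> \<E>"
    proof
      fix F assume F: "F \<in> min_sets (bars \<E> \<inter> FE_edges \<Lambda>)"
      then obtain E where "E \<in> \<E>" "E \<subseteq> F" using below[of F] by (auto simp: min_sets_def)
      then show "F \<in> \<E>" using F sub by (auto simp: min_sets_def)
    qed
    show "\<E> \<subseteq> min_sets (bars \<E> \<inter> FE_edges \<Lambda>)"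
    proof
      fix F assume F: "F \<in> \<E>"
      have "G = F" if "G \<in> bars \<E> \<inter> FE_edges \<Lambda>" "G \<subseteq> F" for G
        using below[OF that(1)] that(2) E(3)[OF _ F] by blast
      then show "F \<in> min_sets (bars \<E> \<inter> FE_edges \<Lambda>)"
        using F sub unfolding min_sets_def by blast
    qed
  qed
qed

lemma satiation_efficient:
  assumes eff: "efficient \<Lambda> \<E>"
  shows "satiation \<Lambda> \<E> = bars \<E>"
  unfolding satiation_def
proof (rule Least_equality)
  note E = efficientD(1,2)[OF eff]
  show "satiated \<Lambda> (bars \<E>) \<and> \<E> \<subseteq> bars \<E>"
    using satiated_bars[OF eff] bar_self[OF _ E(2)] bars_iff[OF E(2)] E(2) by blast
  fix \<G> assume "satiated \<Lambda> \<G> \<and> \<E> \<subseteq> \<G>"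
  then show "bars \<E> \<subseteq> \<G>" using bar_satiated E(1) unfolding bars_def by blast
qed

section \<open>Satiated collections and their minimal edge sets\<close>

text \<open>(S3) selects only one initial edge for each path. Adding the remaining ones by (S1) is
  legitimate because an initial edge of f is determined by its direction, so that only finitely many
  occur.\<close>

lemma initial_edges_satiated:
  assumes sat: "satiated \<Lambda> \<F>" and F: "F \<in> \<F>"
  shows "{e \<in> edges \<Lambda>. \<exists>f\<in>F. e \<preceq> f} \<in> \<F>" (is "?I \<in> \<F>")
proof -
  note S = satiatedD[OF sat]
  have "F \<in> FE \<Lambda>" using F S(1) by blast
  note Fc = FE_cases[OF this]
  have "\<exists>e. e \<in> edges \<Lambda> \<and> e \<preceq> f" if f: "f \<in> F" for f
  proof -
    obtain i where "deg \<Lambda> f i \<noteq> 0"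
      using deg_nonzero[OF Fc(2,4,3) f] by (auto simp: fun_eq_iff)
    then show ?thesis using first_edge f Fc(6) by (metis subsetD)
  qed
  then obtain \<epsilon> where \<epsilon>: "\<And>f. f \<in> F \<Longrightarrow> \<epsilon> f \<in> edges \<Lambda> \<and> \<epsilon> f \<preceq> f" by metis
  let ?J = "(\<lambda>f. initial \<Lambda> f (deg \<Lambda> (\<epsilon> f))) ` F"
  have J: "?J \<in> \<F>"
    using \<epsilon> edge_deg_nonzero prefix_deg_le by (intro S(4)[OF F]) blast
  have JI: "?J \<subseteq> ?I" using \<epsilon> initial_eq by fastforce
  have fin: "finite ?I"
  proof (rule finite_subset)
    show "?I \<subseteq> (\<Union>f\<in>F. range (\<lambda>i. initial \<Lambda> f (\<lambda>j. if j = i then 1 else 0)))"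
    proof
      fix e assume "e \<in> ?I"
      then obtain f i where "f \<in> F" "e \<preceq> f" "deg \<Lambda> e = (\<lambda>j. if j = i then 1 else 0)"
        using edge_deg by blast
      then show "e \<in> (\<Union>f\<in>F. range (\<lambda>i. initial \<Lambda> f (\<lambda>j. if j = i then 1 else 0)))"
        using initial_eq[of e f] by auto
    qed
  qed (use Fc(1) in simp)
  have at: "?I \<subseteq> paths_at \<Lambda> (range_vertex \<Lambda> F) (arr \<Lambda>)"
    using Fc(4) prefix_rng edge_arr by (fastforce simp: paths_at_def)
  have "range_vertex \<Lambda> ?J = range_vertex \<Lambda> F"
    using J S(1) by (intro range_vertex_subset[OF _ Fc(2)]) (use JI at in blast)+
  moreover have "range_vertex \<Lambda> F \<notin> ?I"
    using edge_deg_nonzero vertex_simps(4)[OF Fc(2)] by blast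
  ultimately have "?I \<in> FE \<Lambda>"
    using FE_superset[OF _ JI fin] at J S(1) by auto
  then show ?thesis using S(2)[OF J] JI by blast
qed

text \<open>Minimality is (E1). For (E2) and (E3) the required edge set is first found in \<F>, by
  (S2) and by (S4) followed by (S3) respectively; \<open>below\<close> then shrinks it to a minimal
  one.\<close>

lemma efficient_min_sets:
  assumes sat: "satiated \<Lambda> \<F>"
  shows "efficient \<Lambda> (min_sets (\<F> \<inter> FE_edges \<Lambda>))"
proof -
  let ?M = "min_sets (\<F> \<inter> FE_edges \<Lambda>)"
  note S = satiatedD[OF sat]
  have MF: "E \<in> \<F>" "E \<in> FE \<Lambda>" "E \<subseteq> edges \<Lambda>" "E \<in> FE_edges \<Lambda>" if "E \<in> ?M" for E
    using that FE_edgesD by (auto simp: min_sets_def)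
  have below: "\<exists>G\<in>?M. G \<subseteq> E" if "E \<in> \<F>" "E \<subseteq> edges \<Lambda>" for E
  proof -
    have "E \<in> FE \<Lambda>" using that S(1) by blast
    then have "E \<in> \<F> \<inter> FE_edges \<Lambda>" "finite E"
      using that FE_cases(1) by (auto simp: FE_edges_def)
    then show ?thesis by (rule min_sets_below) blast
  qed
  show ?thesis
    unfolding efficient_def
  proof (intro conjI ballI impI)
    show "?M \<subseteq> FE_edges \<Lambda>" using MF by blast
  next
    fix E F assume "E \<in> ?M" "F \<in> ?M" "E \<subseteq> F" then show "E = F" by (auto simp: min_sets_def)
  next
    fix E f assume E: "E \<in> ?M" and f: "f \<in> paths_at \<Lambda> (range_vertex \<Lambda> E) (edges \<Lambda>) - E"
    note Ec = FE_cases[OF MF(2)[OF E]]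
    have f: "f \<in> edges \<Lambda>" "f \<in> arr \<Lambda>" "rng \<Lambda> f = range_vertex \<Lambda> E" "f \<notin> E"
      using f edge_arr by (auto simp: paths_at_def)
    have "Ext \<Lambda> f E \<in> \<F>"
      using S(3)[OF MF(1)[OF E] f(2,3)] edge_prefix_iff[OF Ec(2,4,3) f(1)] f(4) by simp
    then show "\<exists>F\<in>?M. F \<subseteq> Ext \<Lambda> f E"
      using below Ext_edges[OF f(1,4) MF(3)[OF E]] by blast
  next
    fix E e F assume E: "E \<in> ?M" and e: "e \<in> E" and "F \<in> sets_at \<Lambda> (src \<Lambda> e) ?M"
    then have F: "F \<in> ?M" "range_vertex \<Lambda> F = src \<Lambda> e" by (auto simp: sets_at_def)
    have ee: "e \<in> edges \<Lambda>" "e \<in> arr \<Lambda>" using MF(3)[OF E] e edge_arr by auto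
    have Fp: "f \<in> edges \<Lambda>" "f \<in> arr \<Lambda>" "src \<Lambda> e = rng \<Lambda> f" if "f \<in> F" for f
      using that MF(3)[OF F(1)] FE_cases(4)[OF MF(2)[OF F(1)]] F(2) edge_arr by (auto simp: paths_at_def)
    let ?H = "(E - {e}) \<union> (\<Union>\<mu>\<in>{e}. comp \<Lambda> \<mu> ` F)"
    have H: "?H \<in> \<F>"
      using S(5)[OF MF(1)[OF E], of "{e}" "\<lambda>_. F"] e F MF(1) by simp
    \<comment> \<open>Truncation at \<open>n\<close> fixes the edges of \<open>E\<close> and sends a
      grafted path ef to its initial segment of degree d(f). The two cases do not interfere, since
      by \<open>notE\<close> no ef is in \<open>E\<close>.\<close>
    define n where "n h = (if h \<in> E then deg \<Lambda> h else deg \<Lambda> h - deg \<Lambda> e)" for h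
    have notE: "e \<cdot> f \<notin> E" if "f \<in> F" for f
    proof
      assume "e \<cdot> f \<in> E"
      then have ef: "e \<cdot> f \<in> edges \<Lambda>" using MF(3)[OF E] by auto
      then have "deg \<Lambda> e = deg \<Lambda> (e \<cdot> f)"
        using edge_deg_le_eq edge_deg_nonzero[OF ee(1)] prefix_deg_le prefixI ee Fp[OF that] by metis
      then have "deg \<Lambda> f = 0" using deg_comp ee Fp[OF that] by (simp add: fun_eq_iff)
      then show False using edge_deg_nonzero Fp[OF that] by blast
    qed
    have nf: "n (e \<cdot> f) = deg \<Lambda> f" if "f \<in> F" for f
      using notE[OF that] ee Fp[OF that] by (auto simp: n_def deg_comp fun_eq_iff)
    have ni: "initial \<Lambda> h (n h) = h" if "h \<in> E" for h
      using that MF(3)[OF E] edge_arr initial_eq[OF prefix_refl] by (auto simp: n_def)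
    have "(\<lambda>h. initial \<Lambda> h (n h)) ` ?H \<in> \<F>"
    proof (rule S(4)[OF H])
      fix h assume "h \<in> ?H"
      then consider "h \<in> E" | f where "f \<in> F" "h = e \<cdot> f" by auto
      then show "n h \<noteq> 0 \<and> n h \<le> deg \<Lambda> h"
      proof cases
        case 1
        then show ?thesis using MF(3)[OF E] edge_deg_nonzero by (auto simp: n_def)
      next
        case 2
        then show ?thesis
          using nf Fp edge_deg_nonzero ee by (auto simp: deg_comp le_fun_def)
      qed
    qed
    moreover have "(\<lambda>h. initial \<Lambda> h (n h)) ` ?H
      = (E - {e}) \<union> {initial \<Lambda> (e \<cdot> f) (deg \<Lambda> f) | f. f \<in> F}" (is "_ = ?K")
      using ni nf by (force simp: image_Un image_image)
    ultimately have K: "?K \<in> \<F>" by simp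
    have "initial \<Lambda> (e \<cdot> f) (deg \<Lambda> f) \<in> edges \<Lambda>" if "f \<in> F" for f
    proof -
      have "e \<cdot> f \<in> arr \<Lambda>" "deg \<Lambda> f \<le> deg \<Lambda> (e \<cdot> f)"
        using ee Fp[OF that] by (auto simp: comp_arr deg_comp le_fun_def)
      then show ?thesis using initial_prefix prefix_arr(1) edgeI Fp(1)[OF that] by metis
    qed
    then have "?K \<subseteq> edges \<Lambda>" using MF(3)[OF E] by auto
    then show "\<exists>G\<in>?M. G \<subseteq> ?K" using below K by blast
  qed
qed

text \<open>The first step uses a minimal set \<open>E\<close> of initial edges of \<open>F\<close>.
  Along e in \<open>E\<close>, either e has a prefix in \<open>F\<close> and the recursion stops, or
  (S2) keeps \<open>Ext \<Lambda> e F\<close> in \<F> while the bound \<open>n\<close> decreases by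
  d(e).\<close>

lemma satiated_bar_min_sets:
  assumes sat: "satiated \<Lambda> \<F>" and "F \<in> \<F>" "\<And>f. f \<in> F \<Longrightarrow> deg \<Lambda> f \<le> n"
  shows "bar (min_sets (\<F> \<inter> FE_edges \<Lambda>)) (range_vertex \<Lambda> F) F"
  using assms(2,3)
proof (induction "\<Sum>i\<in>UNIV. n i" arbitrary: n F rule: less_induct)
  case less
  let ?M = "min_sets (\<F> \<inter> FE_edges \<Lambda>)"
  note S = satiatedD[OF sat]
  have "F \<in> FE \<Lambda>" using less.prems S(1) by blast
  note Fc = FE_cases[OF this]
  let ?I = "{e \<in> edges \<Lambda>. \<exists>f\<in>F. e \<preceq> f}"
  have I: "?I \<in> \<F>" using initial_edges_satiated[OF sat less.prems(1)] .
  then have "?I \<in> FE \<Lambda>" using S(1) by blast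
  then obtain E where E: "E \<in> ?M" "E \<subseteq> ?I"
    using min_sets_below[of ?I "\<F> \<inter> FE_edges \<Lambda>"] I FE_cases(1)[of ?I] by (auto simp: FE_edges_def)
  have Eat: "E \<subseteq> paths_at \<Lambda> (range_vertex \<Lambda> F) (arr \<Lambda>)"
    using E(2) Fc(4) prefix_rng prefix_arr by (fastforce simp: paths_at_def)
  show ?case
  proof (rule bar_step[OF Fc(2,1,4) E(1) Eat])
    fix e assume "e \<in> E"
    then obtain f where e: "e \<in> edges \<Lambda>" "f \<in> F" "e \<preceq> f" "e \<in> arr \<Lambda>" "rng \<Lambda> e = range_vertex \<Lambda> F"
      using E(2) Eat by (auto simp: paths_at_def)
    show "bar ?M (src \<Lambda> e) (Ext \<Lambda> e F)"
    proof (cases "\<exists>f\<in>F. f \<preceq> e")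
      case True
      then show ?thesis using bar_Ext_prefix[OF Fc(1,6) e(4)] by blast
    next
      case False
      then have X: "Ext \<Lambda> e F \<in> \<F>" using S(3)[OF less.prems(1) e(4,5)] by blast
      then have r: "range_vertex \<Lambda> (Ext \<Lambda> e F) = src \<Lambda> e"
        using range_vertex_subset[OF _ src_vertex[OF e(4)] Ext_paths_at] S(1) by blast
      obtain i where i: "deg \<Lambda> e = (\<lambda>j. if j = i then 1 else 0)" using e(1) edge_deg by blast
      \<comment> \<open>The choice of \<open>E\<close> among initial edges matters here:
        \<open>n\<close> is positive in the direction of e, so subtracting d(e) lowers the total
        strictly.\<close>
      have en: "deg \<Lambda> e \<le> n" using prefix_deg_le[OF e(3)] less.prems(2)[OF e(2)] by simp
      have lt: "(\<Sum>j\<in>UNIV. (n - deg \<Lambda> e) j) < (\<Sum>j\<in>UNIV. n j)"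
      proof (rule sum_strict_mono_ex1)
        have "1 \<le> n i" using le_funD[OF en, of i] by (simp add: i)
        then have "(n - deg \<Lambda> e) i < n i" by (simp add: i)
        then show "\<exists>j\<in>UNIV. (n - deg \<Lambda> e) j < n j" by blast
      qed auto
      have bound: "deg \<Lambda> g \<le> n - deg \<Lambda> e" if g: "g \<in> Ext \<Lambda> e F" for g
      proof -
        obtain f where f: "f \<in> F" "deg \<Lambda> e + deg \<Lambda> g = sup (deg \<Lambda> e) (deg \<Lambda> f)"
          using g e(4) by (auto simp: deg_comp Ext_iff[OF e(4) Fc(6)])
        then have "deg \<Lambda> e + deg \<Lambda> g \<le> n" using en less.prems(2) by simp
        then show ?thesis by (auto simp: le_fun_def intro: add_le_imp_le_diff simp: add.commute)
      qed
      from less.hyps[OF lt X bound] show ?thesis unfolding r .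
    qed
  qed
qed

lemma satiation_min_sets:
  assumes sat: "satiated \<Lambda> \<F>"
  shows "satiation \<Lambda> (min_sets (\<F> \<inter> FE_edges \<Lambda>)) = \<F>"
proof -
  let ?M = "min_sets (\<F> \<inter> FE_edges \<Lambda>)"
  have eff: "efficient \<Lambda> ?M" using efficient_min_sets[OF sat] .
  have "bars ?M \<subseteq> \<F>"
    using bar_satiated[OF _ sat] efficientD(1)[OF eff] by (force simp: bars_def min_sets_def)
  moreover have "\<F> \<subseteq> bars ?M"
  proof
    fix F assume F: "F \<in> \<F>"
    then have FE: "F \<in> FE \<Lambda>" using sat by (auto simp: satiated_def)
    \<comment> \<open>Any common upper bound of the finitely many degrees would serve.\<close>
    define n where "n i = (\<Sum>f\<in>F. deg \<Lambda> f i)" for i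
    have "deg \<Lambda> f \<le> n" if "f \<in> F" for f
      using that FE_cases(1)[OF FE] by (auto simp: le_fun_def n_def intro: member_le_sum)
    then show "F \<in> bars ?M"
      using satiated_bar_min_sets[OF sat F] bars_iff[OF efficientD(2)[OF eff]] FE by blast
  qed
  ultimately show ?thesis using satiation_efficient[OF eff] by blast
qed

end
theorem theorem5p3:
  fixes \<Lambda> :: "('a, 'k::finite) k_graph_data"
  assumes "finitely_aligned_k_graph \<Lambda>"
  shows "bij_betw (satiation \<Lambda>) {\<E>. efficient \<Lambda> \<E>} {\<F>. satiated \<Lambda> \<F>}
    \<and> (\<forall>\<E>. efficient \<Lambda> \<E> \<longrightarrow> min_sets (satiation \<Lambda> \<E> \<inter> FE_edges \<Lambda>) = \<E>)
    \<and> (\<forall>\<F>. satiated \<Lambda> \<F> \<longrightarrow> efficient \<Lambda> (min_sets (\<F> \<inter> FE_edges \<Lambda>))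
                        \<and> satiation \<Lambda> (min_sets (\<F> \<inter> FE_edges \<Lambda>)) = \<F>)"
proof -
  interpret finitely_aligned_k_graph \<Lambda> by (rule assms)
  have eff: "satiated \<Lambda> (satiation \<Lambda> \<E>)" "min_sets (satiation \<Lambda> \<E> \<inter> FE_edges \<Lambda>) = \<E>"
    if "efficient \<Lambda> \<E>" for \<E>
    using satiation_efficient satiated_bars min_sets_bars that by simp_all
  note sat = efficient_min_sets satiation_min_sets
  have "bij_betw (satiation \<Lambda>) {\<E>. efficient \<Lambda> \<E>} {\<F>. satiated \<Lambda> \<F>}"
    by (rule bij_betw_byWitness[where f' = "\<lambda>\<F>. min_sets (\<F> \<inter> FE_edges \<Lambda>)"])
      (use eff sat in auto)
  then show ?thesis using eff sat by blast
qed

end
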